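(* Let $s$ be a fixed quadratic section. (1) For any symplectic automorphism $f$ of $(H_1(F_g;\mathbb{Z}_2),\cdot)$, there exists a lift $f_\sharp\colon\pi_1(P)\to\pi_1(P)$ of $f_s$, i.e. an automorphism $f_\sharp$ of $\pi_1(P)$ with $h_P\circ f_\sharp=f_s\circ h_P$. (2) For any such $f$ and any such lift $f_\sharp$, and any $\varphi,\varphi'\in\mathcal{E}(q)$: $\varphi$ and $\varphi'$ are $s$-related by $f$ (i.e. $\tilde\varphi=\tilde\varphi'\circ f_s$) if and only if $\pi_\varphi$ and $\pi_{\varphi'}$ are weakly equivalent by $f_\sharp$ (i.e. $\varphi=\varphi'\circ f_\sharp$).
   Context: Setting. $g\ge1$, $F_g$ is the closed oriented surface of genus $g$, and $S^1\hookrightarrow P\xrightarrow{p}F_g$ is a principal $S^1$-bundle with even Chern class $q$. $\pi_1(F_g)=\langle x_1,\dots,x_{2g}\mid \prod_{j=1}^g[x_{2j-1},x_{2j}]\rangle$ is the standard presentation. $u_0\in\pi_1(P)$ is the image of a generator of $\pi_1(S^1)$ (the fiber), and $u_i\in\pi_1(P)$, $1\le i\le 2g$, are chosen with $p_\sharp(u_i)=x_i$, so that $\pi_1(P)=\langle u_0,u_1,\dots,u_{2g}\mid [u_i,u_0]\ (1\le i\le 2g),\ \prod_{\ell=1}^g[u_{2\ell-1},u_{2\ell}]\,u_0^{q}\rangle$. Special coverings. $\mathcal{E}(q)$ is the set of homomorphisms $\varphi\colon\pi_1(P)\to\mathbb{Z}_2$ with $\varphi(u_0)=1$ (the nontrivial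 element of $\mathbb{Z}_2$); these are the monodromies of the special $2$-fold coverings $\pi_\varphi\colon E_\varphi\to P$. Let $h_P\colon\pi_1(P)\to H_1(P;\mathbb{Z}_2)$ and $h_{F_g}\colon\pi_1(F_g)\to H_1(F_g;\mathbb{Z}_2)$ be the mod $2$ Hurewicz maps. Each $\varphi\in\mathcal{E}(q)$ factors uniquely as $\varphi=\tilde\varphi\circ h_P$ with $\tilde\varphi\colon H_1(P;\mathbb{Z}_2)\to\mathbb{Z}_2$ linear. Quadratic section. Put $\sigma_i=h_{F_g}(x_i)$ (a symplectic basis of $H_1(F_g;\mathbb{Z}_2)$ for the mod $2$ intersection product "$\cdot$") and $\nu_i=h_P(u_i)$, $0\le i\le 2g$ (a basis of $H_1(P;\mathbb{Z}_2)$). Given $r_1,\dots,r_{2g}\in\mathbb{Z}_2$, the quadratic section $s$ is the unique map $s\colon H_1(F_g;\mathbb{Z}_2)\to H_1(P;\mathbb{Z}_2)$ with $s(\sigma_i)=\nu_i+r_i\nu_0$ for $1\le i\le 2g$ and $s(a+b)=s(a)+s(b)+(a\cdot b)\nu_0$ for all $a,b$. For a symplectic automorphism $f$ of $(H_1(F_g;\mathbb{Z}_2),\cdot)$, $f_s$ is the linear automorphism of $H_1(P;\mathbb{Z}_2)$ with $f_s(s(\sigma_i))=s(f(\sigma_i))$ for all $1\le i\le 2g$ and $f_s(\nu_0)=\nu_0$. Lift. A lift of an automorphism $K$ of $H_1(P;\mathbb{Z}_2)$ is an automorphism $k$ of $\pi_1(P)$ with $h_P\circ k=K\circ h_P$.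 Coverings $\pi_\varphi,\pi_{\varphi'}$ are weakly equivalent by $k\in\mathrm{Aut}(\pi_1(P))$ iff $\varphi=\varphi'\circ k$. *)

theory Defs
  imports "HOL-Algebra.Algebra" "HOL-Algebra.Bij" "HOL-Algebra.Elementary_Groups"
begin

section \<open>Groups given by generators and relators\<close>

text \<open>The letter \<open>(True, i)\<close> stands for the generator with index \<open>i\<close>, the letter
  \<open>(False, i)\<close> for its formal inverse.\<close>

type_synonym 'i word = "(bool \<times> 'i) list"

definition words :: "'i set \<Rightarrow> 'i word set" where
  "words I = lists (UNIV \<times> I)"

inductive pres_eq :: "'i set \<Rightarrow> 'i word set \<Rightarrow> 'i word \<Rightarrow> 'i word \<Rightarrow> bool"
  for I :: "'i set" and R :: "'i word set" where
  pres_refl: "w \<in> words I \<Longrightarrow> pres_eq I R w w"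
| pres_sym: "pres_eq I R v w \<Longrightarrow> pres_eq I R w v"
| pres_trans: "pres_eq I R u v \<Longrightarrow> pres_eq I R v w \<Longrightarrow> pres_eq I R u w"
| pres_append: "pres_eq I R v v' \<Longrightarrow> pres_eq I R w w' \<Longrightarrow> pres_eq I R (v @ w) (v' @ w')"
| pres_cancel: "i \<in> I \<Longrightarrow> pres_eq I R [(b, i), (\<not> b, i)] []"
| pres_relator: "r \<in> R \<Longrightarrow> r \<in> words I \<Longrightarrow> pres_eq I R r []"

definition pres_class :: "'i set \<Rightarrow> 'i word set \<Rightarrow> 'i word \<Rightarrow> 'i word set" where
  "pres_class I R w = {v. pres_eq I R w v}"

definition presented_group :: "'i set \<Rightarrow> 'i word set \<Rightarrow> 'i word set monoid" where
  "presented_group I R =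
     \<lparr>carrier = pres_class I R ` words I,
      monoid.mult = (\<lambda>A B. \<Union>v\<in>A. \<Union>w\<in>B. pres_class I R (v @ w)),
      one = pres_class I R []\<rparr>"

text \<open>\<open>G = \<langle>u\<^sub>i (i \<in> I) | R\<rangle>\<close>: the group \<open>G\<close> is presented by the elements \<open>u\<^sub>i\<close> and the
  relators \<open>R\<close>.\<close>

definition has_presentation ::
  "('a, 'c) monoid_scheme \<Rightarrow> 'i set \<Rightarrow> ('i \<Rightarrow> 'a) \<Rightarrow> 'i word set \<Rightarrow> bool" where
  "has_presentation G I u R \<longleftrightarrow>
     group G \<and>
     (\<exists>\<theta> \<in> iso (presented_group I R) G. \<forall>i\<in>I. \<theta> (pres_class I R [(True, i)]) = u i)"

lemma pres_eq_in_words: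
  assumes "pres_eq I R v w"
  shows "v \<in> words I \<and> w \<in> words I"
  using assms by induction (auto simp: words_def)

lemma pres_class_eq_iff:
  assumes "v \<in> words I"
  shows "pres_class I R v = pres_class I R w \<longleftrightarrow> pres_eq I R v w"
  using assms unfolding pres_class_def
  by (blast intro: pres_refl pres_sym pres_trans)

lemma mult_pres_class:
  assumes "v \<in> words I" "w \<in> words I"
  shows "pres_class I R v \<otimes>\<^bsub>presented_group I R\<^esub> pres_class I R w = pres_class I R (v @ w)"
  using assms unfolding presented_group_def pres_class_def
  by (auto intro: pres_refl pres_sym pres_trans pres_append)

lemma word_inverse_ex:
  assumes "w \<in> words I"
  shows "\<exists>v \<in> words I. pres_eq I R (v @ w) []"
  using assms
proof (induction w)
  case Nil
  then show ?case by (intro bexI[of _ "[]"]) (auto simp: words_def intro: pres_refl)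
next
  case (Cons l w)
  obtain b i where l: "l = (b, i)" by (cases l)
  have i: "i \<in> I" and w: "w \<in> words I" using Cons.prems l by (auto simp: words_def)
  obtain v where v: "v \<in> words I" "pres_eq I R (v @ w) []" using Cons.IH w by blast
  have "pres_eq I R ([(\<not> b, i), (b, i)] @ w) ([] @ w)"
    using pres_append[OF pres_cancel[OF i, of R "\<not> b"] pres_refl[OF w]] by simp
  then have "pres_eq I R (v @ ([(\<not> b, i), (b, i)] @ w)) (v @ ([] @ w))"
    by (rule pres_append[OF pres_refl[OF v(1)]])
  then have "pres_eq I R ((v @ [(\<not> b, i)]) @ (l # w)) []"
    using l v(2) by (auto intro: pres_trans)
  moreover have "v @ [(\<not> b, i)] \<in> words I" using v(1) i by (auto simp: words_def)
  ultimately show ?case by blast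
qed

lemma group_presented_group: "group (presented_group I R)"
proof (rule groupI)
  have [simp]: "carrier (presented_group I R) = pres_class I R ` words I"
    "\<one>\<^bsub>presented_group I R\<^esub> = pres_class I R []"
    by (simp_all add: presented_group_def)
  have [simp]: "[] \<in> words I" "v @ w \<in> words I \<longleftrightarrow> v \<in> words I \<and> w \<in> words I" for v w :: "'a word"
    by (auto simp: words_def)
  let ?P = "presented_group I R"
  show "\<one>\<^bsub>?P\<^esub> \<in> carrier ?P" by simp
  show "x \<otimes>\<^bsub>?P\<^esub> y \<in> carrier ?P" if "x \<in> carrier ?P" "y \<in> carrier ?P" for x y
    using that by (auto simp: mult_pres_class)
  show "x \<otimes>\<^bsub>?P\<^esub> y \<otimes>\<^bsub>?P\<^esub> z = x \<otimes>\<^bsub>?P\<^esub> (y \<otimes>\<^bsub>?P\<^esub> z)"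
    if "x \<in> carrier ?P" "y \<in> carrier ?P" "z \<in> carrier ?P" for x y z
    using that by (auto simp: mult_pres_class)
  show "\<one>\<^bsub>?P\<^esub> \<otimes>\<^bsub>?P\<^esub> x = x" if "x \<in> carrier ?P" for x
    using that by (auto simp: mult_pres_class)
  show "\<exists>y\<in>carrier ?P. y \<otimes>\<^bsub>?P\<^esub> x = \<one>\<^bsub>?P\<^esub>" if x: "x \<in> carrier ?P" for x
  proof -
    obtain w where w: "w \<in> words I" "x = pres_class I R w" using x by auto
    obtain v where v: "v \<in> words I" "pres_eq I R (v @ w) []" using word_inverse_ex[OF w(1)] by blast
    have "pres_class I R v \<otimes>\<^bsub>?P\<^esub> x = \<one>\<^bsub>?P\<^esub>"
      using v w by (simp add: mult_pres_class pres_class_eq_iff)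
    then show ?thesis using v(1) by auto
  qed
qed


section \<open>Surface groups and circle bundles over surfaces\<close>

definition comm_word :: "'i \<Rightarrow> 'i \<Rightarrow> 'i word" where
  "comm_word i j = [(True, i), (True, j), (False, i), (False, j)]"

definition power_word :: "'i \<Rightarrow> int \<Rightarrow> 'i word" where
  "power_word i q = replicate (nat \<bar>q\<bar>) (q \<ge> 0, i)"

definition surface_relator :: "nat \<Rightarrow> nat word" where
  "surface_relator g = concat (map (\<lambda>l. comm_word (2*l - 1) (2*l)) [1..<g + 1])"

definition surface_group :: "nat \<Rightarrow> ('a, 'c) monoid_scheme \<Rightarrow> (nat \<Rightarrow> 'a) \<Rightarrow> bool" where
  "surface_group g F x \<longleftrightarrow> has_presentation F {1..2*g} x {surface_relator g}"

text \<open>The fundamental group of the total space of a principal circle bundle with Chern class \<open>q\<close>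
  over the closed oriented surface of genus \<open>g\<close>; \<open>u 0\<close> is the class of the fibre, and the
  \<open>u i\<close> with \<open>1 \<le> i \<le> 2 * g\<close> lie over the standard generators of the surface group.\<close>

definition circle_bundle_group ::
  "nat \<Rightarrow> int \<Rightarrow> ('b, 'd) monoid_scheme \<Rightarrow> (nat \<Rightarrow> 'b) \<Rightarrow> bool" where
  "circle_bundle_group g q P u \<longleftrightarrow>
     has_presentation P {0..2*g} u
       ((\<lambda>i. comm_word i 0) ` {1..2*g} \<union> {surface_relator g @ power_word 0 q})"


section \<open>First homology with coefficients modulo 2\<close>

text \<open>Homology groups are written multiplicatively. As they have exponent 2, their linear
  maps over the field with two elements are just the group homomorphisms.\<close>

abbreviation Z2 :: "int monoid" where
  "Z2 \<equiv> integer_mod_group 2"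

text \<open>By the Hurewicz theorem, \<open>H\<^sub>1(X; \<int>\<^sub>2)\<close> is the abelianization of \<open>\<pi>\<^sub>1(X)\<close> modulo
  squares, and the Hurewicz map is the quotient map.\<close>

definition mod2_kernel :: "('a, 'c) monoid_scheme \<Rightarrow> 'a set" where
  "mod2_kernel G =
     generate G (derived_set G (carrier G) \<union> (\<lambda>y. y \<otimes>\<^bsub>G\<^esub> y) ` carrier G)"

definition H1 :: "('a, 'c) monoid_scheme \<Rightarrow> 'a set monoid" where
  "H1 G = G Mod mod2_kernel G"

definition hurewicz :: "('a, 'c) monoid_scheme \<Rightarrow> 'a \<Rightarrow> 'a set" where
  "hurewicz G y = mod2_kernel G #>\<^bsub>G\<^esub> y"

text \<open>The mod 2 intersection product on the homology of the surface: the bilinear form for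
  which \<open>hurewicz F (x i)\<close>, \<open>1 \<le> i \<le> 2 * g\<close>, is a symplectic basis, the pairs of
  dual basis elements being those with indices \<open>2 * l - 1\<close> and \<open>2 * l\<close>.\<close>

definition is_intersection_product ::
  "nat \<Rightarrow> ('a, 'c) monoid_scheme \<Rightarrow> (nat \<Rightarrow> 'a) \<Rightarrow> ('a set \<Rightarrow> 'a set \<Rightarrow> int) \<Rightarrow> bool" where
  "is_intersection_product g F x B \<longleftrightarrow>
     B \<in> carrier (H1 F) \<rightarrow>\<^sub>E (carrier (H1 F) \<rightarrow>\<^sub>E carrier Z2) \<and>
     (\<forall>a \<in> carrier (H1 F). B a \<in> hom (H1 F) Z2) \<and>
     (\<forall>b \<in> carrier (H1 F). (\<lambda>a. B a b) \<in> hom (H1 F) Z2) \<and>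
     (\<forall>i \<in> {1..2*g}. \<forall>j \<in> {1..2*g}.
        B (hurewicz F (x i)) (hurewicz F (x j)) =
          (if \<exists>l \<in> {1..g}. {i, j} = {2*l - 1, 2*l} then 1 else 0))"

definition intersection_product ::
  "nat \<Rightarrow> ('a, 'c) monoid_scheme \<Rightarrow> (nat \<Rightarrow> 'a) \<Rightarrow> 'a set \<Rightarrow> 'a set \<Rightarrow> int" where
  "intersection_product g F x = (THE B. is_intersection_product g F x B)"

definition symplectic_automorphism ::
  "nat \<Rightarrow> ('a, 'c) monoid_scheme \<Rightarrow> (nat \<Rightarrow> 'a) \<Rightarrow> ('a set \<Rightarrow> 'a set) \<Rightarrow> bool" where
  "symplectic_automorphism g F x f \<longleftrightarrow>
     f \<in> auto (H1 F) \<and>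
     (\<forall>a \<in> carrier (H1 F). \<forall>b \<in> carrier (H1 F).
        intersection_product g F x (f a) (f b) = intersection_product g F x a b)"


section \<open>Quadratic sections and the induced automorphisms\<close>

definition is_quadratic_section ::
  "nat \<Rightarrow> ('a, 'c) monoid_scheme \<Rightarrow> (nat \<Rightarrow> 'a) \<Rightarrow> ('b, 'd) monoid_scheme \<Rightarrow> (nat \<Rightarrow> 'b) \<Rightarrow>
   (nat \<Rightarrow> int) \<Rightarrow> ('a set \<Rightarrow> 'b set) \<Rightarrow> bool" where
  "is_quadratic_section g F x P u r s \<longleftrightarrow>
     s \<in> carrier (H1 F) \<rightarrow>\<^sub>E carrier (H1 P) \<and>
     (\<forall>i \<in> {1..2*g}. s (hurewicz F (x i)) =
        hurewicz P (u i) \<otimes>\<^bsub>H1 P\<^esub> (hurewicz P (u 0) [^]\<^bsub>H1 P\<^esub> r i)) \<and>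
     (\<forall>a \<in> carrier (H1 F). \<forall>b \<in> carrier (H1 F). s (a \<otimes>\<^bsub>H1 F\<^esub> b) =
        s a \<otimes>\<^bsub>H1 P\<^esub> s b \<otimes>\<^bsub>H1 P\<^esub>
          (hurewicz P (u 0) [^]\<^bsub>H1 P\<^esub> intersection_product g F x a b))"

definition quadratic_section ::
  "nat \<Rightarrow> ('a, 'c) monoid_scheme \<Rightarrow> (nat \<Rightarrow> 'a) \<Rightarrow> ('b, 'd) monoid_scheme \<Rightarrow> (nat \<Rightarrow> 'b) \<Rightarrow>
   (nat \<Rightarrow> int) \<Rightarrow> 'a set \<Rightarrow> 'b set" where
  "quadratic_section g F x P u r = (THE s. is_quadratic_section g F x P u r s)"

definition induced_automorphism ::
  "nat \<Rightarrow> ('a, 'c) monoid_scheme \<Rightarrow> (nat \<Rightarrow> 'a) \<Rightarrow> ('b, 'd) monoid_scheme \<Rightarrow> (nat \<Rightarrow> 'b) \<Rightarrow>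
   ('a set \<Rightarrow> 'b set) \<Rightarrow> ('a set \<Rightarrow> 'a set) \<Rightarrow> 'b set \<Rightarrow> 'b set" where
  "induced_automorphism g F x P u s f =
     (THE K. K \<in> auto (H1 P) \<and>
        (\<forall>i \<in> {1..2*g}. K (s (hurewicz F (x i))) = s (f (hurewicz F (x i)))) \<and>
        K (hurewicz P (u 0)) = hurewicz P (u 0))"

definition is_lift ::
  "('b, 'd) monoid_scheme \<Rightarrow> ('b set \<Rightarrow> 'b set) \<Rightarrow> ('b \<Rightarrow> 'b) \<Rightarrow> bool" where
  "is_lift P K k \<longleftrightarrow>
     k \<in> auto P \<and> (\<forall>y \<in> carrier P. hurewicz P (k y) = K (hurewicz P y))"


section \<open>Special twofold coverings\<close>

text \<open>A special covering is represented by its monodromy.\<close>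

definition special_monodromies ::
  "('b, 'd) monoid_scheme \<Rightarrow> (nat \<Rightarrow> 'b) \<Rightarrow> ('b \<Rightarrow> int) set" where
  "special_monodromies P u = {\<phi> \<in> hom P Z2. \<phi> (u 0) = 1}"

definition on_homology ::
  "('b, 'd) monoid_scheme \<Rightarrow> ('b \<Rightarrow> int) \<Rightarrow> 'b set \<Rightarrow> int" where
  "on_homology P \<phi> =
     (THE \<psi>. \<psi> \<in> hom (H1 P) Z2 \<and> \<psi> \<in> extensional (carrier (H1 P)) \<and>
        (\<forall>y \<in> carrier P. \<phi> y = \<psi> (hurewicz P y)))"

definition s_related ::
  "nat \<Rightarrow> ('a, 'c) monoid_scheme \<Rightarrow> (nat \<Rightarrow> 'a) \<Rightarrow> ('b, 'd) monoid_scheme \<Rightarrow> (nat \<Rightarrow> 'b) \<Rightarrow>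
   ('a set \<Rightarrow> 'b set) \<Rightarrow> ('a set \<Rightarrow> 'a set) \<Rightarrow> ('b \<Rightarrow> int) \<Rightarrow> ('b \<Rightarrow> int) \<Rightarrow> bool" where
  "s_related g F x P u s f \<phi> \<phi>' \<longleftrightarrow>
     (\<forall>a \<in> carrier (H1 P).
        on_homology P \<phi> a = on_homology P \<phi>' (induced_automorphism g F x P u s f a))"

definition weakly_equivalent_by ::
  "('b, 'd) monoid_scheme \<Rightarrow> ('b \<Rightarrow> 'b) \<Rightarrow> ('b \<Rightarrow> int) \<Rightarrow> ('b \<Rightarrow> int) \<Rightarrow> bool" where
  "weakly_equivalent_by P k \<phi> \<phi>' \<longleftrightarrow> (\<forall>y \<in> carrier P. \<phi> y = \<phi>' (k y))"

end

theory Submission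
  imports Defs "HOL-Library.Z2" "HOL-Library.Function_Algebras"
begin

text \<open>Part (2) is formal. The Hurewicz map \<open>h\<close> of \<open>\<pi>\<^sub>1(P)\<close> is surjective, so the equation
  \<open>\<phi>\<^sup>~ = \<phi>'\<^sup>~ \<circ> f\<^sub>s\<close> may be tested on the classes \<open>h y\<close>. For a lift \<open>k\<close> of \<open>f\<^sub>s\<close> one has
  \<open>f\<^sub>s (h y) = h (k y)\<close>, and there the equation reads \<open>\<phi> y = \<phi>' (k y)\<close>.

  Part (1) is proved in coordinates. As \<open>q\<close> is even, every relator of the two presentations has
  even exponent in every generator. Counting exponents modulo 2 therefore identifies
  \<open>H\<^sub>1(P; \<int>\<^sub>2)\<close> and \<open>H\<^sub>1(F\<^sub>g; \<int>\<^sub>2)\<close> with spaces of bit vectors in which the generators become the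
  standard basis (locale \<open>even_presentation\<close>). The intersection product becomes the standard
  symplectic form \<open>omega\<close>, and the quadratic section becomes
  \<open>v \<mapsto> v + (\<Sum>\<^sub>i r\<^sub>i v\<^sub>i + \<Sum>\<^sub>l v\<^sub>2\<^sub>l\<^sub>-\<^sub>1 v\<^sub>2\<^sub>l) e\<^sub>0\<close>. In particular \<open>s a\<close> always projects to \<open>a\<close>, so that \<open>f\<^sub>s\<close> fixes
  the class \<open>e\<^sub>0\<close> of the fibre and induces \<open>f\<close> modulo \<open>e\<^sub>0\<close>.

  The heart of the matter is \<open>symplectic_realised\<close>: every symplectic map of the vectors over the
  surface is induced, modulo \<open>e\<^sub>0\<close>, by an automorphism of \<open>\<pi>\<^sub>1(P)\<close> that fixes the fibre \<open>u\<^sub>0\<close>. Symplectic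
  maps are products of transvections (\<open>symplectic_generation\<close>), so it is enough to realise the
  transvections \<open>T\<^sub>c\<close>. By \<open>T\<^sub>d T\<^sub>c T\<^sub>d = T\<^sub>c\<^sub>+\<^sub>d\<close> for \<open>c \<cdot> d = 1\<close>, the set of those \<open>c\<close> for which \<open>T\<^sub>c\<close> is
  realised contains \<open>c + d\<close> together with \<open>c\<close> and \<open>d\<close>. It contains \<open>a\<^sub>l\<close>, \<open>b\<^sub>l\<close> and \<open>a\<^sub>l + a\<^sub>l\<^sub>+\<^sub>1\<close>, because
  these transvections are induced by Dehn twists along the Lickorish curves, which are written down
  as automorphisms preserving the product of commutators in the surface relator
  (\<open>twist_automorphism\<close>). The locale \<open>transvection_closed\<close> shows that such a set contains
  all nonzero vectors.

  An automorphism realising \<open>f\<close> modulo \<open>e\<^sub>0\<close> agrees with \<open>f\<^sub>s\<close> on each \<open>u\<^sub>i\<close> up to a multiple of the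
  class of the fibre. Since \<open>u\<^sub>0\<close> is central, \<open>u\<^sub>i \<mapsto> u\<^sub>i u\<^sub>0\<^bsup>n\<^sub>i\<^esup>\<close> defines an automorphism for all
  integers \<open>n\<^sub>i\<close> (\<open>fibre_twist_automorphism\<close>), and composing with a suitable one of these removes the
  discrepancy. The map that the composite induces on homology then has the properties which
  characterize \<open>f\<^sub>s\<close>.\<close>

section \<open>Bit vectors and the standard symplectic form\<close>

text \<open>Bit arithmetic stays in the language of rings, and vectors are added as wholes: rewriting
  with exclusive-or or with pointwise definitions would take both apart.\<close>

declare add_bit_eq_xor [simp del] mult_bit_eq_and [simp del] plus_fun_apply [simp del] zero_fun_apply [simp del]

lemma bit_double [simp]: "(a::bit) + a = 0" "a + (a + b) = b"
  by (cases a; cases b; simp)+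

lemma bit_fun_double [simp]: "(v::'i \<Rightarrow> bit) + v = 0" "v + (v + w) = w"
  by (auto simp: fun_eq_iff plus_fun_apply zero_fun_apply)

definition vectors :: "'i set \<Rightarrow> ('i \<Rightarrow> bit) set" where
  "vectors I = {v. \<forall>i. i \<notin> I \<longrightarrow> v i = 0}"

definition basis_vector :: "'i \<Rightarrow> 'i \<Rightarrow> bit" where
  "basis_vector i = (\<lambda>j. if j = i then 1 else 0)"

lemma basis_vector_in_vectors [simp]: "basis_vector i \<in> vectors I \<longleftrightarrow> i \<in> I"
  by (auto simp: vectors_def basis_vector_def)

lemma zero_in_vectors [simp]: "0 \<in> vectors I"
  by (simp add: vectors_def plus_fun_apply zero_fun_apply)

lemma add_in_vectors [simp]: "v \<in> vectors I \<Longrightarrow> w \<in> vectors I \<Longrightarrow> v + w \<in> vectors I"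
  by (simp add: vectors_def plus_fun_apply zero_fun_apply)

lemma sum_fun_apply: "(\<Sum>a\<in>A. f a) i = (\<Sum>a\<in>A. f a i :: bit)"
  by (induction A rule: infinite_finite_induct) (auto simp: plus_fun_apply zero_fun_apply)

lemma vector_decomposition:
  assumes "finite I" "v \<in> vectors I"
  shows "v = (\<Sum>i\<in>I. if v i = 1 then basis_vector i else 0)"
proof
  fix j
  have "(\<Sum>i\<in>I. (if v i = 1 then basis_vector i else 0) j) = (\<Sum>i\<in>I. if i = j then v j else 0)"
    by (rule sum.cong) (auto simp: basis_vector_def zero_fun_apply)
  then show "v j = (\<Sum>i\<in>I. if v i = 1 then basis_vector i else 0) j"
    using assms by (auto simp: sum_fun_apply vectors_def)
qed

lemma vectors_induct [consumes 2, case_names zero basis add]: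
  assumes "finite I" "v \<in> vectors I"
    and "Q 0" "\<And>i. i \<in> I \<Longrightarrow> Q (basis_vector i)"
    and "\<And>v w. v \<in> vectors I \<Longrightarrow> w \<in> vectors I \<Longrightarrow> Q v \<Longrightarrow> Q w \<Longrightarrow> Q (v + w)"
  shows "Q v"
proof -
  have "Q (\<Sum>i\<in>J. if v i = 1 then basis_vector i else 0) \<and>
    (\<Sum>i\<in>J. if v i = 1 then basis_vector i else 0) \<in> vectors I" if "J \<subseteq> I" for J
    using finite_subset[OF that assms(1)] that
    by (induction J rule: finite_induct) (use assms(3-5) in auto)
  then show ?thesis
    using vector_decomposition[OF assms(1,2)] by (metis subset_refl)
qed

definition omega :: "nat \<Rightarrow> (nat \<Rightarrow> bit) \<Rightarrow> (nat \<Rightarrow> bit) \<Rightarrow> bit" where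
  "omega g v w = (\<Sum>l\<in>{1..g}. v (2*l - 1) * w (2*l) + v (2*l) * w (2*l - 1))"

lemma omega_add [simp]:
  "omega g (v + v') w = omega g v w + omega g v' w"
  "omega g w (v + v') = omega g w v + omega g w v'"
  by (simp_all add: omega_def plus_fun_apply zero_fun_apply algebra_simps sum.distrib)

lemma omega_zero [simp]: "omega g 0 w = 0" "omega g w 0 = 0"
  by (simp_all add: omega_def zero_fun_apply)

lemma omega_self [simp]: "omega g v v = 0"
  by (simp add: omega_def mult.commute)

lemma omega_commute: "omega g v w = omega g w v"
  by (simp add: omega_def algebra_simps)

definition handle_a :: "nat \<Rightarrow> nat \<Rightarrow> bit" where "handle_a l = basis_vector (2*l - 1)"
definition handle_b :: "nat \<Rightarrow> nat \<Rightarrow> bit" where "handle_b l = basis_vector (2*l)"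

lemma handle_ab_in_vectors:
  assumes "l \<in> {1..g}"
  shows "handle_a l \<in> vectors {1..2*g}" "handle_b l \<in> vectors {1..2*g}"
  using assms by (auto simp: handle_a_def handle_b_def)

declare handle_ab_in_vectors [simplified, simp]

lemma omega_handle:
  assumes "l \<in> {1..g}"
  shows "omega g v (handle_a l) = v (2*l)" "omega g v (handle_b l) = v (2*l - 1)"
    "omega g (handle_a l) v = v (2*l)" "omega g (handle_b l) v = v (2*l - 1)"
proof -
  have *: "omega g v (handle_a l) = v (2*l)" for v
  proof -
    have "omega g v (handle_a l) = (\<Sum>m\<in>{1..g}. if m = l then v (2*l) else 0)"
      unfolding omega_def
    proof (rule sum.cong)
      fix m assume "m \<in> {1..g}"
      then have "2*m - 1 \<noteq> 2*l" "2*m \<noteq> 2*l - 1" "2*m - 1 = 2*l - 1 \<longleftrightarrow> m = l"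
        using assms by (auto, presburger+)
      then show "v (2*m - 1) * handle_a l (2*m) + v (2*m) * handle_a l (2*m - 1) = (if m = l then v (2*l) else 0)"
        by (auto simp: basis_vector_def handle_a_def handle_b_def)
    qed simp
    then show ?thesis using assms by simp
  qed
  have **: "omega g v (handle_b l) = v (2*l - 1)" for v
  proof -
    have "omega g v (handle_b l) = (\<Sum>m\<in>{1..g}. if m = l then v (2*l - 1) else 0)"
      unfolding omega_def
    proof (rule sum.cong)
      fix m assume "m \<in> {1..g}"
      then have "2*m - 1 \<noteq> 2*l" "2*m \<noteq> 2*l - 1" "2*m - 1 = 2*l - 1 \<longleftrightarrow> m = l"
        using assms by (auto, presburger+)
      then show "v (2*m - 1) * handle_b l (2*m) + v (2*m) * handle_b l (2*m - 1) = (if m = l then v (2*l - 1) else 0)"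
        by (auto simp: basis_vector_def handle_a_def handle_b_def)
    qed simp
    then show ?thesis using assms by simp
  qed
  show "omega g v (handle_a l) = v (2*l)" "omega g v (handle_b l) = v (2*l - 1)"
    "omega g (handle_a l) v = v (2*l)" "omega g (handle_b l) v = v (2*l - 1)"
    using * ** omega_commute by metis+
qed

lemma omega_basis_vector:
  assumes "i \<in> {1..2*g}"
  shows "omega g (basis_vector i) (basis_vector j) = (if \<exists>l \<in> {1..g}. {i, j} = {2*l - 1, 2*l} then 1 else 0)"
proof -
  have odd_even: "2*l - 1 \<noteq> 2*m" "2*l \<noteq> 2*m - 1" "2*m - 1 = 2*l - 1 \<longleftrightarrow> m = l"
    if "l \<ge> 1" "m \<ge> 1" for l m :: nat
    using that by presburger+
  define l where "l = (i + 1) div 2"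
  have l: "l \<in> {1..g}" and "i = 2*l - 1 \<or> i = 2*l"
    using assms by (auto simp: l_def)
  then consider "i = 2*l - 1" | "i = 2*l" by blast
  then show ?thesis
  proof cases
    case 1
    then have "(\<exists>m \<in> {1..g}. {i, j} = {2*m - 1, 2*m}) \<longleftrightarrow> 2*l = j"
      using l odd_even by (fastforce simp: doubleton_eq_iff)
    moreover have "omega g (basis_vector i) (basis_vector j) = basis_vector j (2*l)"
      using omega_handle(3)[OF l] 1 by (simp add: handle_a_def)
    ultimately show ?thesis by (auto simp: basis_vector_def)
  next
    case 2
    then have "(\<exists>m \<in> {1..g}. {i, j} = {2*m - 1, 2*m}) \<longleftrightarrow> 2*l - 1 = j"
      using l odd_even by (fastforce simp: doubleton_eq_iff)
    moreover have "omega g (basis_vector i) (basis_vector j) = basis_vector j (2*l - 1)"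
      using omega_handle(4)[OF l] 2 by (simp add: handle_b_def)
    ultimately show ?thesis by (auto simp: basis_vector_def)
  qed
qed

lemma omega_handles [simp]:
  assumes "l \<in> {1..g}" "m \<in> {1..g}"
  shows "omega g (handle_a l) (handle_a m) = 0" "omega g (handle_b l) (handle_b m) = 0"
    "omega g (handle_a l) (handle_b m) = (if l = m then 1 else 0)"
    "omega g (handle_b l) (handle_a m) = (if l = m then 1 else 0)"
proof -
  have "2*l \<noteq> 2*m - 1" "2*l - 1 \<noteq> 2*m" "2*l - 1 = 2*m - 1 \<longleftrightarrow> l = m"
    using assms by (auto, presburger+)
  then show "omega g (handle_a l) (handle_a m) = 0" "omega g (handle_b l) (handle_b m) = 0"
    "omega g (handle_a l) (handle_b m) = (if l = m then 1 else 0)"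
    "omega g (handle_b l) (handle_a m) = (if l = m then 1 else 0)"
    by (simp_all add: omega_handle[OF assms(1)]) (simp_all add: handle_a_def handle_b_def basis_vector_def)
qed

text \<open>Over the field with two elements the scalar factor of a transvection is a condition.\<close>

definition transvection :: "nat \<Rightarrow> (nat \<Rightarrow> bit) \<Rightarrow> (nat \<Rightarrow> bit) \<Rightarrow> (nat \<Rightarrow> bit)" where
  "transvection g c v = v + (if omega g v c = 1 then c else 0)"

lemma transvection_add:
  "transvection g c (v + w) = transvection g c v + transvection g c w"
  by (cases "omega g v c"; cases "omega g w c") (auto simp: transvection_def fun_eq_iff plus_fun_apply zero_fun_apply algebra_simps)

lemma omega_transvection: "omega g (transvection g c v) (transvection g c w) = omega g v w"
  by (cases "omega g v c"; cases "omega g w c")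
     (auto simp: transvection_def omega_commute[of g c v] omega_commute[of g c w] algebra_simps)

lemma transvection_involution [simp]: "transvection g c (transvection g c v) = v"
  by (cases "omega g v c") (auto simp: transvection_def algebra_simps)

text \<open>Conjugating \<open>T\<^sub>c\<close> by a symplectic map gives the transvection of the image of \<open>c\<close>, and
  \<open>T\<^sub>d\<close> is an involution that maps \<open>c\<close> to \<open>c + d\<close>.\<close>

lemma transvection_conjugate:
  assumes "omega g c d = 1"
  shows "transvection g d (transvection g c (transvection g d v)) = transvection g (c + d) v"
  using assms by (cases "omega g v c"; cases "omega g v d")
    (auto simp: transvection_def omega_commute[of g d c] algebra_simps)

text \<open>Bijectivity on the vectors supported in \<open>{1..2*g}\<close> is a consequence, because the form is
  nondegenerate there.\<close>

definition symplectic :: "nat \<Rightarrow> ((nat \<Rightarrow> bit) \<Rightarrow> (nat \<Rightarrow> bit)) \<Rightarrow> bool" where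
  "symplectic g L \<longleftrightarrow> (\<forall>v\<in>vectors {1..2*g}. L v \<in> vectors {1..2*g}) \<and>
     (\<forall>v\<in>vectors {1..2*g}. \<forall>w\<in>vectors {1..2*g}.
        L (v + w) = L v + L w \<and> omega g (L v) (L w) = omega g v w)"

lemma symplectic_transvection_comp:
  assumes "symplectic g L" "c \<in> vectors {1..2*g}"
  shows "symplectic g (transvection g c \<circ> L)"
  using assms unfolding symplectic_def
  by (auto simp: transvection_add omega_transvection) (auto simp: transvection_def)

section \<open>Sets of vectors closed under transvections\<close>

definition nonzero_handle_vectors :: "nat \<Rightarrow> (nat \<Rightarrow> bit) set" where
  "nonzero_handle_vectors l = {handle_a l, handle_b l, handle_a l + handle_b l}"

lemma omega_distinct_handles:
  assumes "l \<in> {1..g}" "m \<in> {1..g}" "l \<noteq> m" "x \<in> nonzero_handle_vectors l" "y \<in> nonzero_handle_vectors m"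
  shows "omega g x y = 0"
  using assms by (auto simp: nonzero_handle_vectors_def simp del: atLeastAtMost_iff)

lemma omega_same_handle:
  assumes "l \<in> {1..g}" "x \<in> nonzero_handle_vectors l" "y \<in> nonzero_handle_vectors l" "x \<noteq> y"
  shows "omega g x y = 1" "x + y \<in> nonzero_handle_vectors l"
  using assms by (auto simp: nonzero_handle_vectors_def add_ac simp del: atLeastAtMost_iff)

lemma omega_sum_other_handles:
  assumes "finite S" "S \<subseteq> {1..g}" "m \<in> {1..g}" "m \<notin> S" "y \<in> nonzero_handle_vectors m"
    "\<And>l. l \<in> S \<Longrightarrow> x l \<in> nonzero_handle_vectors l"
  shows "omega g (\<Sum>l\<in>S. x l) y = 0"
  using assms(1,2,4,6)
proof (induction S rule: finite_induct)
  case (insert l S)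
  have "omega g (x l) y = 0"
    using insert.prems assms by (intro omega_distinct_handles[of l g m]) auto
  then show ?case using insert by simp
qed simp

text \<open>The example behind this locale is the set of all \<open>c\<close> whose transvection belongs to a given
  group of maps. The starting vectors are the classes of the Lickorish curves.\<close>

locale transvection_closed =
  fixes g :: nat and T :: "(nat \<Rightarrow> bit) set"
  assumes handle_a_in: "l \<in> {1..g} \<Longrightarrow> handle_a l \<in> T"
    and handle_b_in: "l \<in> {1..g} \<Longrightarrow> handle_b l \<in> T"
    and adjacent_in: "l \<in> {1..g} \<Longrightarrow> Suc l \<in> {1..g} \<Longrightarrow> handle_a l + handle_a (Suc l) \<in> T"
    and add_in: "c \<in> T \<Longrightarrow> d \<in> T \<Longrightarrow> omega g c d = 1 \<Longrightarrow> c + d \<in> T"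
begin

lemma handle_in:
  assumes "l \<in> {1..g}" "x \<in> nonzero_handle_vectors l" shows "x \<in> T"
  using assms handle_a_in handle_b_in add_in[OF handle_a_in[OF assms(1)] handle_b_in[OF assms(1)]]
  by (auto simp: nonzero_handle_vectors_def simp del: atLeastAtMost_iff)

text \<open>The three nonzero vectors of a handle have pairwise product 1, so adding \<open>x + y\<close> to a member of
  \<open>T\<close> exchanges its component \<open>x\<close> in the handle for \<open>y\<close>. Membership therefore depends only on
  the set of handles in which a vector has a nonzero component.\<close>

lemma replace_handle:
  assumes "l \<in> {1..g}" "x \<in> nonzero_handle_vectors l" "y \<in> nonzero_handle_vectors l"
    and "\<And>z. z \<in> nonzero_handle_vectors l \<Longrightarrow> omega g w z = 0" and "w + x \<in> T"
  shows "w + y \<in> T"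
proof (cases "x = y")
  case False
  note xy = omega_same_handle[OF assms(1-3) False]
  have "omega g (w + x) (x + y) = 1"
    using assms(4)[OF xy(2)] xy(1) by simp
  from add_in[OF assms(5) handle_in[OF assms(1) xy(2)] this]
  show ?thesis by (simp add: add_ac)
qed (use assms in simp)

text \<open>The partner \<open>j\<close> moves to \<open>Suc j\<close> in two steps: adding \<open>a\<^sub>j + a\<^sub>j\<^sub>+\<^sub>1\<close> spreads the vector to a third
  handle, and adding a vector on the handles \<open>j\<close> and \<open>j + 1\<close> clears the handle \<open>j\<close>.\<close>

lemma two_handles_in:
  assumes "i \<in> {1..g}" "i < j" "j \<le> g"
  shows "handle_a i + handle_a j \<in> T"
proof -
  have "Suc i \<le> j" using assms by simp
  then show ?thesis using \<open>j \<le> g\<close>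
  proof (induction j rule: dec_induct)
    case base
    then show ?case using adjacent_in[of i] assms by simp
  next
    case (step j)
    let ?k = "Suc j"
    have j: "j \<in> {1..g}" and k: "?k \<in> {1..g}" and ne: "i \<noteq> j" "i \<noteq> ?k" "j \<noteq> ?k"
      using step assms by auto
    note om = assms(1) j k ne
    have "handle_a i + handle_b j \<in> T"
      using step.IH step.prems by (intro replace_handle[of j "handle_a j" "handle_b j" "handle_a i"]) (use om in \<open>auto simp: nonzero_handle_vectors_def simp del: atLeastAtMost_iff\<close>)
    moreover have "omega g (handle_a i + handle_b j) (handle_a j + handle_a ?k) = 1"
      using om by (simp del: atLeastAtMost_iff)
    ultimately have "(handle_a i + handle_b j) + (handle_a j + handle_a ?k) \<in> T"
      using add_in adjacent_in j k by blast
    then have "(handle_a i + handle_a ?k) + (handle_a j + handle_b j) \<in> T"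
      by (simp add: add_ac)
    then have 1: "(handle_a i + handle_a ?k) + handle_b j \<in> T"
      by (intro replace_handle[of j "handle_a j + handle_b j" "handle_b j" "handle_a i + handle_a ?k"])
        (use om in \<open>auto simp: nonzero_handle_vectors_def simp del: atLeastAtMost_iff\<close>)
    have "handle_a ?k + handle_a j \<in> T"
      using adjacent_in[OF j k] by (simp add: add_ac)
    then have "handle_a ?k + handle_b j \<in> T"
      by (intro replace_handle[of j "handle_a j" "handle_b j" "handle_a ?k"]) (use om in \<open>auto simp: nonzero_handle_vectors_def simp del: atLeastAtMost_iff\<close>)
    then have "handle_b j + handle_a ?k \<in> T"
      by (simp add: add_ac)
    then have "handle_b j + handle_b ?k \<in> T"
      by (intro replace_handle[of ?k "handle_a ?k" "handle_b ?k" "handle_b j"]) (use om in \<open>auto simp: nonzero_handle_vectors_def simp del: atLeastAtMost_iff\<close>)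
    moreover have "omega g ((handle_a i + handle_a ?k) + handle_b j) (handle_b j + handle_b ?k) = 1"
      using om by (simp del: atLeastAtMost_iff)
    ultimately have "((handle_a i + handle_a ?k) + handle_b j) + (handle_b j + handle_b ?k) \<in> T"
      using add_in 1 by blast
    then have "handle_a i + (handle_a ?k + handle_b ?k) \<in> T"
      by (simp add: add_ac)
    then show ?case
      by (intro replace_handle[of ?k "handle_a ?k + handle_b ?k" "handle_a ?k" "handle_a i"])
        (use om in \<open>auto simp: nonzero_handle_vectors_def simp del: atLeastAtMost_iff\<close>)
  qed
qed

text \<open>A new handle \<open>j\<close> is attached through a handle \<open>i\<close> that is already present: after the component at
  \<open>i\<close> is set to \<open>b\<^sub>i\<close>, the vector has product 1 with \<open>a\<^sub>i + a\<^sub>j\<close>, and the components at \<open>i\<close> and \<open>j\<close>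
  can then be adjusted freely.\<close>

lemma sum_handles_in:
  assumes "finite S" "S \<noteq> {}" "S \<subseteq> {1..g}" "\<And>l. l \<in> S \<Longrightarrow> x l \<in> nonzero_handle_vectors l"
  shows "(\<Sum>l\<in>S. x l) \<in> T"
  using assms
proof (induction S arbitrary: x rule: finite_ne_induct)
  case (singleton l)
  then show ?case using handle_in[of l "x l"] by auto
next
  case (insert j S)
  obtain i where i: "i \<in> S" using insert.hyps by blast
  let ?w = "\<Sum>l\<in>S - {i}. x l"
  have ij: "i \<in> {1..g}" "j \<in> {1..g}" "i \<noteq> j" "S - {i} \<subseteq> {1..g}" and
    xij: "x i \<in> nonzero_handle_vectors i" "x j \<in> nonzero_handle_vectors j"
    using i insert by auto
  have w: "omega g ?w z = 0" if "m \<in> {i, j}" "z \<in> nonzero_handle_vectors m" for m z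
    using that insert ij by (intro omega_sum_other_handles[where m = m]) auto
  have "(\<Sum>l\<in>S. (x(i := handle_b i)) l) \<in> T"
    by (rule insert.IH) (use insert.prems in \<open>auto simp: nonzero_handle_vectors_def\<close>)
  moreover have "(\<Sum>l\<in>S. (x(i := handle_b i)) l) = handle_b i + ?w"
    using insert.hyps(1) i by (subst sum.remove[of S i]) auto
  ultimately have "handle_b i + ?w \<in> T" by simp
  moreover have "handle_a i + handle_a j \<in> T"
    using two_handles_in[of i j] two_handles_in[of j i] ij by (cases "i < j") (auto simp: add_ac)
  moreover have "omega g (handle_b i + ?w) (handle_a i + handle_a j) = 1"
    using w[of i "handle_a i"] w[of j "handle_a j"] ij(1-3)
    by (simp add: nonzero_handle_vectors_def del: atLeastAtMost_iff)
  ultimately have "(handle_b i + ?w) + (handle_a i + handle_a j) \<in> T"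
    using add_in by blast
  then have "(?w + handle_a j) + (handle_a i + handle_b i) \<in> T"
    by (simp add: add_ac)
  then have "(?w + handle_a j) + x i \<in> T"
    by (rule replace_handle[of i "handle_a i + handle_b i" "x i", rotated 4])
      (use ij xij w[of i] omega_distinct_handles[of j g i "handle_a j"] in \<open>auto simp: nonzero_handle_vectors_def\<close>)
  then have "(?w + x i) + handle_a j \<in> T"
    by (simp add: add_ac)
  then have "(?w + x i) + x j \<in> T"
    by (rule replace_handle[of j "handle_a j" "x j", rotated 4])
      (use ij xij w[of j] omega_distinct_handles[of i g j "x i"] in \<open>auto simp: nonzero_handle_vectors_def\<close>)
  moreover have "(\<Sum>l\<in>insert j S. x l) = (?w + x i) + x j"
    using insert.hyps i by (simp add: sum.remove[of S i] add_ac)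
  ultimately show ?case by simp
qed

lemma nonzero_in:
  assumes "v \<in> vectors {1..2*g}" "v \<noteq> 0"
  shows "v \<in> T"
proof -
  define x where "x l = (if v (2*l - 1) = 1 then handle_a l else 0) + (if v (2*l) = 1 then handle_b l else 0)" for l
  define S where "S = {l \<in> {1..g}. v (2*l - 1) = 1 \<or> v (2*l) = 1}"
  have "{1..2*g} = (\<lambda>l. 2*l - 1) ` {1..g} \<union> (\<lambda>l. 2*l) ` {1..g}"
  proof (intro equalityI subsetI)
    fix i assume "i \<in> {1..2*g}"
    then have "(i + 1) div 2 \<in> {1..g}" "i = 2*((i + 1) div 2) - 1 \<or> i = 2*((i + 1) div 2)"
      by auto
    then show "i \<in> (\<lambda>l. 2*l - 1) ` {1..g} \<union> (\<lambda>l. 2*l) ` {1..g}"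
      by blast
  qed auto
  moreover have "(\<lambda>l. 2*l - 1) ` {1..g} \<inter> (\<lambda>l. 2*l) ` {1..g} = {}"
    by (auto, presburger)
  moreover have "inj_on (\<lambda>l. 2*l - 1) {1..g}" "inj_on (\<lambda>l::nat. 2*l) {1..g}"
    by (auto simp: inj_on_def)
  ultimately have split: "(\<Sum>i\<in>{1..2*g}. f i) = (\<Sum>l\<in>{1..g}. f (2*l - 1) + f (2*l))"
    for f :: "nat \<Rightarrow> nat \<Rightarrow> bit"
    by (simp add: sum.union_disjoint sum.reindex sum.distrib)
  have "v = (\<Sum>l\<in>{1..g}. x l)"
    using vector_decomposition[OF _ assms(1)] unfolding split x_def handle_a_def handle_b_def
    by blast
  also have "\<dots> = (\<Sum>l\<in>S. x l)"
    by (rule sum.mono_neutral_right) (auto simp: S_def x_def)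
  finally have v: "v = (\<Sum>l\<in>S. x l)" .
  then have "S \<noteq> {}" using assms(2) by auto
  then show ?thesis
    unfolding v by (intro sum_handles_in) (auto simp: S_def x_def nonzero_handle_vectors_def)
qed

end

section \<open>Transvections generate the symplectic group\<close>

text \<open>A map is reduced to the identity by making it fix \<open>a\<^sub>1, b\<^sub>1, a\<^sub>2, b\<^sub>2, \<dots>\<close> in turn, each time by
  composing it with at most two transvections that do not disturb what is already fixed.
  The statement is phrased as an induction principle for a property \<open>Q\<close> of maps.\<close>

lemma symplectic_generation:
  fixes Q :: "((nat \<Rightarrow> bit) \<Rightarrow> (nat \<Rightarrow> bit)) \<Rightarrow> bool"
  assumes id: "\<And>L. (\<And>v. v \<in> vectors {1..2*g} \<Longrightarrow> L v = v) \<Longrightarrow> Q L"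
    and step: "\<And>c L. c \<in> vectors {1..2*g} \<Longrightarrow> symplectic g L \<Longrightarrow> Q (transvection g c \<circ> L) \<Longrightarrow> Q L"
    and "symplectic g L"
  shows "Q L"
proof -
  let ?V = "vectors {1..2*g}"
  have L_in: "L v \<in> ?V" and L_add: "L (v + w) = L v + L w" and
    L_omega: "omega g (L v) (L w) = omega g v w"
    if "symplectic g L" "v \<in> ?V" "w \<in> ?V" for L v w
    using that by (auto simp: symplectic_def)
  \<comment> \<open>If \<open>L p\<close> and \<open>p\<close> have product 1, the transvection of \<open>L p + p\<close> takes \<open>L p\<close> to \<open>p\<close>. In general an
    intermediate vector \<open>z\<close> is used: two transvections take \<open>L p\<close> to \<open>z\<close> and \<open>z\<close> to \<open>p\<close>. The
    vectors \<open>L p + z\<close> and \<open>z + p\<close> are orthogonal to \<open>U\<close>, which is why \<open>U\<close> remains fixed.\<close>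
  have fix_one: "Q L"
    if L: "symplectic g L" and U: "U \<subseteq> ?V" "\<And>u. u \<in> U \<Longrightarrow> L u = u" and p: "p \<in> ?V"
      and z: "omega g (L p) p = 1 \<or>
        (\<exists>z \<in> ?V. omega g z (L p) = 1 \<and> omega g z p = 1 \<and> (\<forall>u\<in>U. omega g u z = omega g u p))"
      and Q: "\<And>L. symplectic g L \<Longrightarrow> (\<And>u. u \<in> U \<Longrightarrow> L u = u) \<Longrightarrow> L p = p \<Longrightarrow> Q L"
    for L U p
  proof -
    have Lp: "L p \<in> ?V" using L_in L p by blast
    have up: "omega g u (L p) = omega g u p" if "u \<in> U" for u
      using L_omega[OF L _ p, of u] U that by auto
    from z show ?thesis
    proof
      assume 1: "omega g (L p) p = 1"
      let ?c = "L p + p"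
      have c: "?c \<in> ?V" using Lp p by simp
      show "Q L"
      proof (rule step[OF c L], rule Q)
        show "symplectic g (transvection g ?c \<circ> L)"
          using symplectic_transvection_comp[OF L c] .
        show "(transvection g ?c \<circ> L) u = u" if "u \<in> U" for u
          using that U up by (simp add: transvection_def)
        show "(transvection g ?c \<circ> L) p = p"
          using 1 by (simp add: transvection_def)
      qed
    next
      assume "\<exists>z \<in> ?V. omega g z (L p) = 1 \<and> omega g z p = 1 \<and> (\<forall>u\<in>U. omega g u z = omega g u p)"
      then obtain z where z: "z \<in> ?V" "omega g z (L p) = 1" "omega g z p = 1"
        "\<And>u. u \<in> U \<Longrightarrow> omega g u z = omega g u p" by blast
      let ?c = "L p + z" and ?d = "z + p"
      have c: "?c \<in> ?V" "?d \<in> ?V" using Lp p z by auto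
      let ?M = "transvection g ?c \<circ> L"
      have M: "symplectic g ?M" using symplectic_transvection_comp[OF L c(1)] .
      have Mp: "?M p = z"
        using z(2) by (simp add: transvection_def omega_commute[of g _ z])
      have Mu: "?M u = u" if "u \<in> U" for u
        using that U up z(4) by (simp add: transvection_def)
      show "Q L"
      proof (rule step[OF c(1) L], rule step[OF c(2) M], rule Q)
        show "symplectic g (transvection g ?d \<circ> ?M)"
          using symplectic_transvection_comp[OF M c(2)] .
        show "(transvection g ?d \<circ> ?M) u = u" if "u \<in> U" for u
          using that Mu z(4) by (simp add: transvection_def)
        show "(transvection g ?d \<circ> ?M) p = p"
          unfolding o_apply[of "transvection g ?d" ?M] Mp using z(3) by (simp add: transvection_def)
      qed
    qed
  qed
  define U where "U k = handle_a ` {1..k} \<union> handle_b ` {1..k}" for k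
  have "Q L" if "symplectic g L" "\<And>u. u \<in> U k \<Longrightarrow> L u = u" "k \<le> g" for L k
    using that(3,1,2)
  proof (induction k arbitrary: L rule: inc_induct)
    case base
    have fixed: "L (basis_vector i) = basis_vector i" if "i \<in> {1..2*g}" for i
    proof -
      have "(i + 1) div 2 \<in> {1..g}" "i = 2*((i + 1) div 2) - 1 \<or> i = 2*((i + 1) div 2)"
        using that by auto
      then have "basis_vector i = handle_a ((i + 1) div 2) \<or> basis_vector i = handle_b ((i + 1) div 2)" 
        unfolding handle_a_def handle_b_def by metis
      then have "basis_vector i \<in> U g"
        using \<open>(i + 1) div 2 \<in> {1..g}\<close> unfolding U_def by blast
      then show ?thesis using base by blast
    qed
    have zero: "L 0 = 0"
      using L_add[OF base(1), of 0 0] by (metis add_0 bit_fun_double(1) zero_in_vectors)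
    have "finite {1..2*g}" by simp
    then have "L v = v" if "v \<in> ?V" for v
      using that
    proof (induction v rule: vectors_induct)
      case (add v w)
      then show ?case using L_add[OF base(1), of v w] by simp
    qed (fact zero fixed)+
    then show ?case by (rule id)
  next
    case (step k)
    let ?a = "handle_a (Suc k)" and ?d = "handle_b (Suc k)"
    have k: "Suc k \<in> {1..g}" using step by auto
    have ad: "?a \<in> ?V" "?d \<in> ?V" "omega g ?a ?d = 1" using k by auto
    have U: "U k \<subseteq> ?V" using step by (auto simp: U_def)
    have perp: "omega g u ?a = 0" "omega g u ?d = 0" if "u \<in> U k" for u
      using that k step by (auto simp: U_def)
    have Suc: "U (Suc k) = insert ?d (insert ?a (U k))"
      by (auto simp: U_def atLeastAtMostSuc_conv)
    show ?case
    proof (rule fix_one[OF step.prems(1) U step.prems(2) ad(1)])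
      let ?v = "L ?a" and ?w = "L ?d"
      have Lu: "omega g u ?w = 0" if "u \<in> U k" for u
        using L_omega[OF step.prems(1) _ ad(2), of u] step.prems(2)[OF that] that U perp(2)[OF that] by auto
      have L: "?v \<in> ?V" "?w \<in> ?V" "omega g ?v ?w = 1"
        using L_in L_omega step.prems(1) ad by auto
      note comm = omega_commute[of g ?v ?d] omega_commute[of g ?a ?d] omega_commute[of g ?a ?w]
        omega_commute[of g ?v ?w]
      \<comment> \<open>One of \<open>?d\<close>, \<open>?w\<close> and \<open>?d + ?w\<close> always serves as the intermediate vector.\<close>
      consider "omega g ?v ?d = 1" | "omega g ?a ?w = 1" | "omega g ?v ?d = 0" "omega g ?a ?w = 0"
        by (metis bit_not_zero_iff)
      then have "\<exists>z \<in> ?V. omega g z ?v = 1 \<and> omega g z ?a = 1 \<and> (\<forall>u\<in>U k. omega g u z = 0)"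
      proof cases
        case 1
        then show ?thesis using ad perp by (intro bexI[of _ ?d]) (auto simp: comm)
      next
        case 2
        then show ?thesis using L Lu by (intro bexI[of _ ?w]) (auto simp: comm)
      next
        case 3
        then show ?thesis using L Lu ad perp
          by (intro bexI[of _ "?d + ?w"]) (auto simp: comm)
      qed
      then show "omega g ?v ?a = 1 \<or>
        (\<exists>z \<in> ?V. omega g z ?v = 1 \<and> omega g z ?a = 1 \<and> (\<forall>u\<in>U k. omega g u z = omega g u ?a))"
        using perp by auto
    next
      fix M assume M: "symplectic g M" "\<And>u. u \<in> U k \<Longrightarrow> M u = u" "M ?a = ?a"
      show "Q M"
      proof (rule fix_one[OF M(1), of "insert ?a (U k)" ?d])
        let ?w = "M ?d"
        have w: "?w \<in> ?V" "omega g ?a ?w = 1"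
          using L_in[OF M(1) ad(2,2)] L_omega[OF M(1) ad(1,2)] M(3) ad by auto
        have wu: "omega g u ?w = 0" if "u \<in> U k" for u
          using L_omega[OF M(1) _ ad(2), of u] M(2)[OF that] that U perp(2)[OF that] by auto
        show "omega g ?w ?d = 1 \<or> (\<exists>z \<in> ?V. omega g z ?w = 1 \<and> omega g z ?d = 1 \<and>
            (\<forall>u\<in>insert ?a (U k). omega g u z = omega g u ?d))"
        proof (cases "omega g ?w ?d = 1")
          case False
          then show ?thesis using w wu ad perp by (intro disjI2 bexI[of _ "?w + ?a"]) auto
        qed simp
      next
        fix N assume "symplectic g N" "\<And>u. u \<in> insert ?a (U k) \<Longrightarrow> N u = u" "N ?d = ?d"
        then show "Q N" by (intro step.IH) (auto simp: Suc)
      qed (use M U ad in auto)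
    qed
  qed
  from this[of L 0] show ?thesis
    using assms(3) by (auto simp: U_def)
qed

section \<open>Homomorphisms out of a presented group\<close>

fun letter :: "('a, 'c) monoid_scheme \<Rightarrow> ('i \<Rightarrow> 'a) \<Rightarrow> bool \<times> 'i \<Rightarrow> 'a" where
  "letter G u (b, i) = (if b then u i else inv\<^bsub>G\<^esub> u i)"

definition eval_word :: "('a, 'c) monoid_scheme \<Rightarrow> ('i \<Rightarrow> 'a) \<Rightarrow> 'i word \<Rightarrow> 'a" where
  "eval_word G u w = foldr (\<lambda>l y. letter G u l \<otimes>\<^bsub>G\<^esub> y) w \<one>\<^bsub>G\<^esub>"

lemma eval_word_simps [simp]:
  "eval_word G u [] = \<one>\<^bsub>G\<^esub>"
  "eval_word G u (l # w) = letter G u l \<otimes>\<^bsub>G\<^esub> eval_word G u w"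
  by (simp_all add: eval_word_def)

lemma words_simps [simp]:
  "[] \<in> words I" "(l # w) \<in> words I \<longleftrightarrow> snd l \<in> I \<and> w \<in> words I"
  "v @ w \<in> words I \<longleftrightarrow> v \<in> words I \<and> w \<in> words I"
  by (cases l; auto simp: words_def)+

context group
begin

lemma letter_closed: "u \<in> I \<rightarrow> carrier G \<Longrightarrow> snd l \<in> I \<Longrightarrow> letter G u l \<in> carrier G"
  by (cases l) auto

lemma eval_word_closed [simp]:
  "u \<in> I \<rightarrow> carrier G \<Longrightarrow> w \<in> words I \<Longrightarrow> eval_word G u w \<in> carrier G"
  by (induction w) (auto simp: letter_closed)

lemma eval_word_append:
  "u \<in> I \<rightarrow> carrier G \<Longrightarrow> v \<in> words I \<Longrightarrow> w \<in> words I \<Longrightarrow>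
    eval_word G u (v @ w) = eval_word G u v \<otimes> eval_word G u w"
  by (induction v) (auto simp: letter_closed m_assoc)

lemma eval_word_pres_eq:
  assumes "pres_eq I R v w" "u \<in> I \<rightarrow> carrier G" "\<And>r. r \<in> R \<Longrightarrow> eval_word G u r = \<one>"
  shows "eval_word G u v = eval_word G u w"
  using assms(1)
proof (induction rule: pres_eq.induct)
  case (pres_append v v' w w')
  then show ?case
    using pres_eq_in_words[of I R v v'] pres_eq_in_words[of I R w w']
    by (simp add: eval_word_append[OF assms(2)])
next
  case (pres_cancel i b)
  then show ?case using funcset_mem[OF assms(2), of i] by (cases b) auto
qed (use assms(3) in auto)

lemma mult_inv_cancel_left [simp]:
  "x \<in> carrier G \<Longrightarrow> y \<in> carrier G \<Longrightarrow> x \<otimes> (inv x \<otimes> y) = y"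
  "x \<in> carrier G \<Longrightarrow> y \<in> carrier G \<Longrightarrow> inv x \<otimes> (x \<otimes> y) = y"
  by (simp_all add: m_assoc[symmetric])

lemma eval_word_in_subgroup:
  assumes "subgroup H G" "\<And>i. i \<in> I \<Longrightarrow> u i \<in> H" "w \<in> words I"
  shows "eval_word G u w \<in> H"
  using assms(3)
proof (induction w)
  case (Cons l w)
  then show ?case
    using assms by (cases l) (auto intro: subgroup.m_closed subgroup.m_inv_closed)
qed (use assms(1) in \<open>auto intro: subgroup.one_closed\<close>)

end

lemma presented_group_carrier: "carrier (presented_group I R) = pres_class I R ` words I"
  by (simp add: presented_group_def)

text \<open>A homomorphism is determined on words by its values on letters, and the value on the inverse of a
  generator is forced.\<close>

lemma presentation_isomorphism:
  assumes "has_presentation G I u R"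
  obtains \<theta> where "\<theta> \<in> iso (presented_group I R) G" "u \<in> I \<rightarrow> carrier G"
    "\<And>w. w \<in> words I \<Longrightarrow> \<theta> (pres_class I R w) = eval_word G u w"
proof -
  obtain \<theta> where \<theta>: "\<theta> \<in> iso (presented_group I R) G"
    "\<And>i. i \<in> I \<Longrightarrow> \<theta> (pres_class I R [(True, i)]) = u i" and G: "group G"
    using assms by (auto simp: has_presentation_def)
  let ?P = "presented_group I R"
  interpret P: group ?P by (rule group_presented_group)
  interpret G: group G by (rule G)
  interpret \<theta>: group_hom ?P G \<theta>
    by unfold_locales (use \<theta>(1) in \<open>simp add: iso_def\<close>)
  have cl [simp]: "pres_class I R w \<in> carrier ?P" if "w \<in> words I" for w
    using that by (simp add: presented_group_carrier)
  have u: "u \<in> I \<rightarrow> carrier G"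
  proof
    fix i assume "i \<in> I"
    then show "u i \<in> carrier G" using \<theta>.hom_closed[OF cl, of "[(True, i)]"] by (simp add: \<theta>(2))
  qed
  have letter: "\<theta> (pres_class I R [l]) = letter G u l" if "snd l \<in> I" for l
  proof (cases l)
    case (Pair b i)
    have i: "i \<in> I" using that Pair by simp
    have "pres_class I R [(False, i)] \<otimes>\<^bsub>?P\<^esub> pres_class I R [(True, i)] = \<one>\<^bsub>?P\<^esub>"
    proof -
      have "pres_class I R [(False, i)] \<otimes>\<^bsub>?P\<^esub> pres_class I R [(True, i)] = pres_class I R [(False, i), (True, i)]"
        using i by (subst mult_pres_class) auto
      also have "\<dots> = pres_class I R []"
        using i pres_cancel[OF i, of R False] by (simp add: pres_class_eq_iff)
      finally show ?thesis by (simp add: presented_group_def)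
    qed
    then have "\<theta> (pres_class I R [(False, i)]) \<otimes>\<^bsub>G\<^esub> u i = \<one>\<^bsub>G\<^esub>"
      using i \<theta>.hom_mult[of "pres_class I R [(False, i)]" "pres_class I R [(True, i)]"]
      by (simp add: \<theta>(2))
    then have "\<theta> (pres_class I R [(False, i)]) = inv\<^bsub>G\<^esub> u i"
      using i u \<theta>.hom_closed[OF cl, of "[(False, i)]"] by (intro G.inv_equality[symmetric]) auto
    then show ?thesis using Pair i \<theta>(2) by simp
  qed
  have "\<theta> (pres_class I R w) = eval_word G u w" if "w \<in> words I" for w
    using that
  proof (induction w)
    case Nil
    have "pres_class I R [] = \<one>\<^bsub>?P\<^esub>" by (simp add: presented_group_def)
    then show ?case by simp
  next
    case (Cons l w)
    have "pres_class I R (l # w) = pres_class I R [l] \<otimes>\<^bsub>?P\<^esub> pres_class I R w"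
      using Cons.prems by (subst mult_pres_class) auto
    then show ?case using Cons by (simp add: letter)
  qed
  with \<theta>(1) u show thesis using that by blast
qed

lemma presentation_generator_closed:
  assumes "has_presentation G I u R"
  shows "u \<in> I \<rightarrow> carrier G"
proof -
  obtain \<theta> where "u \<in> I \<rightarrow> carrier G"
    using presentation_isomorphism[OF assms] by metis
  then show ?thesis .
qed

lemma presentation_generates:
  assumes "has_presentation G I u R" "y \<in> carrier G"
  obtains w where "w \<in> words I" "y = eval_word G u w"
proof -
  obtain \<theta> where \<theta>: "\<theta> \<in> iso (presented_group I R) G"
    "\<And>w. w \<in> words I \<Longrightarrow> \<theta> (pres_class I R w) = eval_word G u w"
    using presentation_isomorphism[OF assms(1)] by metis
  have "\<theta> ` carrier (presented_group I R) = carrier G"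
    using \<theta>(1) by (simp add: iso_def bij_betw_def)
  then have "y \<in> \<theta> ` (pres_class I R ` words I)"
    using assms(2) by (simp only: presented_group_carrier)
  then obtain w where "w \<in> words I" "\<theta> (pres_class I R w) = y"
    by (elim imageE) simp
  then show thesis using that \<theta>(2) by simp
qed

lemma presentation_relator:
  assumes "has_presentation G I u R" "r \<in> R" "r \<in> words I"
  shows "eval_word G u r = \<one>\<^bsub>G\<^esub>"
proof -
  obtain \<theta> where \<theta>: "\<And>w. w \<in> words I \<Longrightarrow> \<theta> (pres_class I R w) = eval_word G u w"
    using presentation_isomorphism[OF assms(1)] by metis
  have "pres_class I R r = pres_class I R []"
    using assms pres_relator by (simp add: pres_class_eq_iff)
  then show ?thesis using \<theta>[of r] \<theta>[of "[]"] assms by simp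
qed

text \<open>Words with the same value in \<open>G\<close> are equivalent under the relators, so their values under \<open>v\<close>
  agree as well.\<close>

lemma presentation_universal:
  assumes "has_presentation G I u R" "group H" "v \<in> I \<rightarrow> carrier H"
    and "\<And>r. r \<in> R \<Longrightarrow> eval_word H v r = \<one>\<^bsub>H\<^esub>"
  obtains h where "h \<in> hom G H" "\<And>i. i \<in> I \<Longrightarrow> h (u i) = v i"
proof -
  interpret H: group H by fact
  obtain \<theta> where \<theta>: "\<theta> \<in> iso (presented_group I R) G" and u: "u \<in> I \<rightarrow> carrier G" and
    eval: "\<And>w. w \<in> words I \<Longrightarrow> \<theta> (pres_class I R w) = eval_word G u w"
    using presentation_isomorphism[OF assms(1)] by metis
  have G: "group G" using assms(1) by (simp add: has_presentation_def)
  interpret G: group G by fact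
  \<comment> \<open>Injectivity of the isomorphism turns equal values into equivalent words.\<close>
  have well_defined: "eval_word H v w = eval_word H v w'"
    if "w \<in> words I" "w' \<in> words I" "eval_word G u w = eval_word G u w'" for w w'
  proof -
    have "inj_on \<theta> (carrier (presented_group I R))"
      using \<theta> by (simp add: iso_def bij_betw_def)
    then have "pres_class I R w = pres_class I R w'"
      by (rule inj_onD) (use that eval in \<open>simp_all add: presented_group_carrier\<close>)
    then show ?thesis
      using H.eval_word_pres_eq[OF _ assms(3,4)] pres_class_eq_iff[OF that(1)] by blast
  qed
  define h where "h y = eval_word H v (SOME w. w \<in> words I \<and> eval_word G u w = y)" for y
  have h: "h (eval_word G u w) = eval_word H v w" if "w \<in> words I" for w
  proof -
    let ?w' = "SOME w'. w' \<in> words I \<and> eval_word G u w' = eval_word G u w"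
    have "?w' \<in> words I \<and> eval_word G u ?w' = eval_word G u w"
      by (rule someI_ex) (use that in blast)
    then show ?thesis unfolding h_def using that well_defined by blast
  qed
  show thesis
  proof
    show "h \<in> hom G H"
    proof (rule homI)
      fix y z assume "y \<in> carrier G" "z \<in> carrier G"
      then obtain w w' where w: "w \<in> words I" "y = eval_word G u w" "w' \<in> words I" "z = eval_word G u w'"
        using presentation_generates[OF assms(1)] by metis
      then show "h y \<in> carrier H"
        using H.eval_word_closed[OF assms(3)] by (simp add: h)
      have "h (y \<otimes>\<^bsub>G\<^esub> z) = h (eval_word G u (w @ w'))"
        using w G.eval_word_append[OF u] by simp
      also have "\<dots> = h y \<otimes>\<^bsub>H\<^esub> h z"
        using w by (simp add: h H.eval_word_append[OF assms(3)])
      finally show "h (y \<otimes>\<^bsub>G\<^esub> z) = h y \<otimes>\<^bsub>H\<^esub> h z" .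
    qed
    show "h (u i) = v i" if "i \<in> I" for i
      using h[of "[(True, i)]"] that u assms(3) by (auto simp: Pi_def)
  qed
qed

lemma presentation_hom_unique:
  assumes "has_presentation G I u R" "group H" "h \<in> hom G H" "h' \<in> hom G H"
    and "\<And>i. i \<in> I \<Longrightarrow> h (u i) = h' (u i)" and "y \<in> carrier G"
  shows "h y = h' y"
proof -
  have G: "group G" using assms(1) by (simp add: has_presentation_def)
  interpret h: group_hom G H h using G assms(2,3) by (simp add: group_hom_def group_hom_axioms_def)
  interpret h': group_hom G H h' using G assms(2,4) by (simp add: group_hom_def group_hom_axioms_def)
  have "subgroup {y \<in> carrier G. h y = h' y} G"
    by (rule subgroup.intro) auto
  moreover note u = presentation_generator_closed[OF assms(1)]
  moreover obtain w where "w \<in> words I" "y = eval_word G u w"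
    using presentation_generates[OF assms(1,6)] by metis
  ultimately show ?thesis
    using h.G.eval_word_in_subgroup[of "{y \<in> carrier G. h y = h' y}" I u w] assms(5) by (auto simp: Pi_def)
qed

section \<open>First homology modulo 2\<close>

text \<open>These are the targets of the homomorphisms that factor through homology modulo 2. Both the
  coefficient group and the homology groups themselves belong to this class.\<close>

definition elementary_2_group :: "('a, 'c) monoid_scheme \<Rightarrow> bool" where
  "elementary_2_group A \<longleftrightarrow> comm_group A \<and> (\<forall>a\<in>carrier A. a \<otimes>\<^bsub>A\<^esub> a = \<one>\<^bsub>A\<^esub>)"

lemma elementary_2_group_Z2: "elementary_2_group Z2"
  by (auto simp: elementary_2_group_def carrier_integer_mod_group)

context group
begin

lemma mod2_kernel_generators: "derived_set G (carrier G) \<union> (\<lambda>y. y \<otimes> y) ` carrier G \<subseteq> carrier G"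
  by auto

lemma normal_mod2_kernel: "mod2_kernel G \<lhd> G"
  unfolding mod2_kernel_def
proof (rule normal_generateI[OF mod2_kernel_generators])
  fix h k assume h: "h \<in> derived_set G (carrier G) \<union> (\<lambda>y. y \<otimes> y) ` carrier G" and k: "k \<in> carrier G"
  from h show "k \<otimes> h \<otimes> inv k \<in> derived_set G (carrier G) \<union> (\<lambda>y. y \<otimes> y) ` carrier G"
  proof
    assume "h \<in> derived_set G (carrier G)"
    then obtain a b where ab: "a \<in> carrier G" "b \<in> carrier G" "h = a \<otimes> b \<otimes> inv a \<otimes> inv b"
      by auto
    let ?a = "k \<otimes> a \<otimes> inv k" and ?b = "k \<otimes> b \<otimes> inv k"
    have "k \<otimes> h \<otimes> inv k = ?a \<otimes> ?b \<otimes> inv ?a \<otimes> inv ?b" "?a \<in> carrier G" "?b \<in> carrier G"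
      using ab k by (simp_all add: m_assoc inv_mult_group)
    then show ?thesis
      by (intro UnI1 UN_I[of ?a] UN_I[of ?b]) simp_all
  next
    assume "h \<in> (\<lambda>y. y \<otimes> y) ` carrier G"
    then obtain a where a: "a \<in> carrier G" "h = a \<otimes> a" by blast
    let ?a = "k \<otimes> a \<otimes> inv k"
    have "k \<otimes> h \<otimes> inv k = ?a \<otimes> ?a" "?a \<in> carrier G"
      using a k by (simp_all add: m_assoc)
    then show ?thesis
      by (intro UnI2 image_eqI[of _ _ ?a])
  qed
qed

lemma mod2_kernel_subgroup: "subgroup (mod2_kernel G) G"
  using normal_mod2_kernel by (rule normal_imp_subgroup)

lemma mod2_kernel_square: "a \<in> carrier G \<Longrightarrow> a \<otimes> a \<in> mod2_kernel G"
  unfolding mod2_kernel_def by (rule generate.incl, intro UnI2 imageI)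

lemma group_H1: "group (H1 G)"
  unfolding H1_def using normal_mod2_kernel by (rule normal.factorgroup_is_group)

lemma carrier_H1: "carrier (H1 G) = hurewicz G ` carrier G"
  by (auto simp: H1_def carrier_FactGroup hurewicz_def)

lemma H1_cases [consumes 1, case_names hurewicz]:
  assumes "a \<in> carrier (H1 G)"
  obtains y where "y \<in> carrier G" "a = hurewicz G y"
proof -
  obtain y where "a = hurewicz G y" "y \<in> carrier G"
    using assms unfolding carrier_H1 by (rule imageE)
  then show thesis by (rule that[rotated])
qed

lemma hurewicz_closed [simp]: "y \<in> carrier G \<Longrightarrow> hurewicz G y \<in> carrier (H1 G)"
  by (simp add: carrier_H1)

lemma hurewicz_hom: "hurewicz G \<in> hom G (H1 G)"
  unfolding H1_def hurewicz_def[abs_def] using normal_mod2_kernel by (rule normal.r_coset_hom_Mod)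

lemma hurewicz_mult:
  "y \<in> carrier G \<Longrightarrow> z \<in> carrier G \<Longrightarrow> hurewicz G (y \<otimes> z) = hurewicz G y \<otimes>\<^bsub>H1 G\<^esub> hurewicz G z"
  using hurewicz_hom by (simp add: hom_def)

lemma hurewicz_one_iff:
  assumes "y \<in> carrier G"
  shows "hurewicz G y = \<one>\<^bsub>H1 G\<^esub> \<longleftrightarrow> y \<in> mod2_kernel G"
proof
  assume "hurewicz G y = \<one>\<^bsub>H1 G\<^esub>"
  then have "mod2_kernel G #> y = mod2_kernel G"
    by (simp add: hurewicz_def H1_def)
  then show "y \<in> mod2_kernel G"
    using rcos_self[OF assms mod2_kernel_subgroup] by simp
next
  assume "y \<in> mod2_kernel G"
  then show "hurewicz G y = \<one>\<^bsub>H1 G\<^esub>"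
    using assms coset_join2[OF assms mod2_kernel_subgroup] by (simp add: hurewicz_def H1_def)
qed

lemma elementary_2_group_H1: "elementary_2_group (H1 G)"
proof -
  have square: "a \<otimes>\<^bsub>H1 G\<^esub> a = \<one>\<^bsub>H1 G\<^esub>" if a: "a \<in> carrier (H1 G)" for a
  proof -
    obtain y where y: "y \<in> carrier G" "a = hurewicz G y"
      using a by (rule H1_cases)
    then have "a \<otimes>\<^bsub>H1 G\<^esub> a = hurewicz G (y \<otimes> y)"
      by (simp only: hurewicz_mult)
    also have "\<dots> = \<one>\<^bsub>H1 G\<^esub>"
      using hurewicz_one_iff[OF m_closed[OF y(1) y(1)]] mod2_kernel_square[OF y(1)] by simp
    finally show ?thesis .
  qed
  have inv_self: "inv\<^bsub>H1 G\<^esub> a = a" if "a \<in> carrier (H1 G)" for a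
    by (rule group.inv_equality[OF group_H1 square[OF that] that that])
  have "comm_group (H1 G)"
  proof (rule group.group_comm_groupI[OF group_H1])
    fix a b assume ab: "a \<in> carrier (H1 G)" "b \<in> carrier (H1 G)"
    then have "a \<otimes>\<^bsub>H1 G\<^esub> b = inv\<^bsub>H1 G\<^esub> (a \<otimes>\<^bsub>H1 G\<^esub> b)"
      using inv_self[of "a \<otimes>\<^bsub>H1 G\<^esub> b"] monoid.m_closed[OF group.is_monoid[OF group_H1] ab] by simp
    also have "\<dots> = b \<otimes>\<^bsub>H1 G\<^esub> a"
      using group.inv_mult_group[OF group_H1 ab] inv_self ab by simp
    finally show "a \<otimes>\<^bsub>H1 G\<^esub> b = b \<otimes>\<^bsub>H1 G\<^esub> a" .
  qed
  with square show ?thesis by (simp add: elementary_2_group_def)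
qed

lemma comm_group_H1: "comm_group (H1 G)"
  using elementary_2_group_H1 by (simp add: elementary_2_group_def)

lemma mod2_kernel_in_kernel:
  assumes "elementary_2_group A" "h \<in> hom G A" "y \<in> mod2_kernel G"
  shows "h y = \<one>\<^bsub>A\<^esub>"
proof -
  interpret A: comm_group A using assms by (simp add: elementary_2_group_def)
  interpret h: group_hom G A h by unfold_locales (rule assms)
  have "derived_set G (carrier G) \<union> (\<lambda>y. y \<otimes> y) ` carrier G \<subseteq> kernel G A h"
  proof -
    have "h (a \<otimes> b \<otimes> inv a \<otimes> inv b) = \<one>\<^bsub>A\<^esub>" if "a \<in> carrier G" "b \<in> carrier G" for a b
      using that by (simp add: A.m_comm[of "h a" "h b"] A.m_assoc)
    moreover have "h (a \<otimes> a) = \<one>\<^bsub>A\<^esub>" if "a \<in> carrier G" for a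
      using that assms(1) by (simp add: elementary_2_group_def)
    ultimately show ?thesis by (auto simp: kernel_def)
  qed
  then have "mod2_kernel G \<subseteq> kernel G A h"
    unfolding mod2_kernel_def by (rule generate_subgroup_incl[OF _ h.subgroup_kernel])
  then show ?thesis using assms(3) by (auto simp: kernel_def)
qed

lemma hom_eq_if_hurewicz_eq:
  assumes "elementary_2_group A" "h \<in> hom G A" "y \<in> carrier G" "z \<in> carrier G"
    "hurewicz G y = hurewicz G z"
  shows "h y = h z"
proof -
  interpret A: comm_group A using assms by (simp add: elementary_2_group_def)
  interpret h: group_hom G A h by unfold_locales (rule assms)
  have "hurewicz G (y \<otimes> inv z) = hurewicz G (z \<otimes> inv z)"
    using assms(3-5) by (simp only: hurewicz_mult inv_closed)
  then have "hurewicz G (y \<otimes> inv z) = \<one>\<^bsub>H1 G\<^esub>"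
    using assms(4) hurewicz_one_iff[of \<one>] subgroup.one_closed[OF mod2_kernel_subgroup] by simp
  then have "h (y \<otimes> inv z) = \<one>\<^bsub>A\<^esub>"
    using assms mod2_kernel_in_kernel hurewicz_one_iff by blast
  then have "h y \<otimes>\<^bsub>A\<^esub> inv\<^bsub>A\<^esub> h z = \<one>\<^bsub>A\<^esub>"
    using assms by simp
  then show ?thesis
    using assms A.inv_equality A.inv_inv h.hom_closed A.inv_closed by metis
qed

text \<open>This one factorization gives the map \<open>on_homology\<close> of a monodromy, the coordinates on homology,
  and the map on homology induced by an endomorphism.\<close>

lemma hom_factors_through_H1:
  assumes "elementary_2_group A" "h \<in> hom G A"
  obtains \<psi> where "\<psi> \<in> hom (H1 G) A" "\<psi> \<in> extensional (carrier (H1 G))"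
    "\<And>y. y \<in> carrier G \<Longrightarrow> \<psi> (hurewicz G y) = h y"
proof
  let ?\<psi> = "\<lambda>a\<in>carrier (H1 G). h (SOME y. y \<in> carrier G \<and> hurewicz G y = a)"
  show eq: "?\<psi> (hurewicz G y) = h y" if "y \<in> carrier G" for y
  proof -
    let ?z = "SOME z. z \<in> carrier G \<and> hurewicz G z = hurewicz G y"
    have "?z \<in> carrier G \<and> hurewicz G ?z = hurewicz G y"
      by (rule someI_ex) (use that in blast)
    then show ?thesis
      using that hom_eq_if_hurewicz_eq[OF assms, of ?z y] by simp
  qed
  show "?\<psi> \<in> hom (H1 G) A"
  proof (rule homI)
    fix a b assume "a \<in> carrier (H1 G)" "b \<in> carrier (H1 G)"
    then obtain y z where yz: "y \<in> carrier G" "a = hurewicz G y" "z \<in> carrier G" "b = hurewicz G z"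
      using H1_cases by metis
    show "?\<psi> a \<in> carrier A"
      unfolding yz(2) eq[OF yz(1)] using assms(2) yz(1) by (auto simp: hom_def)
    show "?\<psi> (a \<otimes>\<^bsub>H1 G\<^esub> b) = ?\<psi> a \<otimes>\<^bsub>A\<^esub> ?\<psi> b"
      unfolding yz(2,4) hurewicz_mult[OF yz(1,3), symmetric] eq[OF yz(1)] eq[OF yz(3)]
        eq[OF m_closed[OF yz(1,3)]]
      using assms(2) yz(1,3) by (auto simp: hom_def)
  qed
  show "?\<psi> \<in> extensional (carrier (H1 G))" by (rule restrict_extensional)
qed

end

section \<open>Coordinates on homology for even presentations\<close>

definition vector_group :: "'i set \<Rightarrow> ('i \<Rightarrow> bit) monoid" where
  "vector_group I = \<lparr>carrier = vectors I, monoid.mult = (+), one = 0\<rparr>"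

lemma vector_group_simps [simp]:
  "carrier (vector_group I) = vectors I" "x \<otimes>\<^bsub>vector_group I\<^esub> y = x + y" "\<one>\<^bsub>vector_group I\<^esub> = 0"
  by (simp_all add: vector_group_def)

lemma elementary_2_group_vectors: "elementary_2_group (vector_group I)"
proof -
  have "comm_group (vector_group I)"
  proof (rule comm_groupI)
    show "\<exists>w\<in>carrier (vector_group I). w \<otimes>\<^bsub>vector_group I\<^esub> v = \<one>\<^bsub>vector_group I\<^esub>"
      if "v \<in> carrier (vector_group I)" for v :: "'a \<Rightarrow> bit"
      using that by (intro bexI[of _ v]) auto
  qed (auto simp: add_ac)
  then show ?thesis by (simp add: elementary_2_group_def)
qed

lemma group_vectors: "group (vector_group I)"
  using elementary_2_group_vectors by (auto simp: elementary_2_group_def comm_group_def)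

text \<open>The condition on the relators says that every generator occurs an even number of times, inverses
  counted alike. It is what makes the classes of the generators linearly independent.\<close>

locale even_presentation = group G for G :: "('a, 'c) monoid_scheme" (structure) +
  fixes I :: "'i set" and u :: "'i \<Rightarrow> 'a" and R :: "'i word set"
  assumes presentation: "has_presentation G I u R"
    and finite_generators: "finite I"
    and even_relators: "r \<in> R \<Longrightarrow> eval_word (vector_group I) basis_vector r = 0"
begin

definition parity :: "'a \<Rightarrow> 'i \<Rightarrow> bit" where
  "parity = (SOME h. h \<in> hom G (vector_group I) \<and> (\<forall>i\<in>I. h (u i) = basis_vector i))"

lemma generator_closed [simp]: "i \<in> I \<Longrightarrow> u i \<in> carrier G"
  using presentation_generator_closed[OF presentation] by (rule funcset_mem)

lemma parity_hom: "parity \<in> hom G (vector_group I)"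
  and parity_generator [simp]: "i \<in> I \<Longrightarrow> parity (u i) = basis_vector i"
proof -
  have "\<exists>h. h \<in> hom G (vector_group I) \<and> (\<forall>i\<in>I. h (u i) = basis_vector i)"
    by (rule presentation_universal[OF presentation group_vectors, of basis_vector])
      (use even_relators in auto)
  then have "parity \<in> hom G (vector_group I) \<and> (\<forall>i\<in>I. parity (u i) = basis_vector i)"
    unfolding parity_def by (rule someI_ex)
  then show "parity \<in> hom G (vector_group I)" "i \<in> I \<Longrightarrow> parity (u i) = basis_vector i"
    by blast+
qed

lemma parity_in_vectors [simp]: "y \<in> carrier G \<Longrightarrow> parity y \<in> vectors I"
  using parity_hom by (auto simp: hom_def)

lemma parity_mult [simp]: "y \<in> carrier G \<Longrightarrow> z \<in> carrier G \<Longrightarrow> parity (y \<otimes> z) = parity y + parity z"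
  using parity_hom by (auto simp: hom_def)

lemma parity_one [simp]: "parity \<one> = 0"
  using parity_mult[of \<one> \<one>] by simp

lemma parity_inv [simp]:
  assumes "y \<in> carrier G"
  shows "parity (inv y) = parity y"
proof -
  have "parity y + parity (inv y) = 0"
    using parity_mult[of y "inv y"] assms by simp
  then have "parity y + (parity y + parity (inv y)) = parity y"
    by simp
  then show ?thesis by simp
qed

definition coords :: "'a set \<Rightarrow> 'i \<Rightarrow> bit" where
  "coords = (SOME \<psi>. \<psi> \<in> hom (H1 G) (vector_group I) \<and> (\<forall>y\<in>carrier G. \<psi> (hurewicz G y) = parity y))"

lemma coords_hom: "coords \<in> hom (H1 G) (vector_group I)"
  and coords_hurewicz [simp]: "y \<in> carrier G \<Longrightarrow> coords (hurewicz G y) = parity y"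
proof -
  have "\<exists>\<psi>. \<psi> \<in> hom (H1 G) (vector_group I) \<and> (\<forall>y\<in>carrier G. \<psi> (hurewicz G y) = parity y)"
    by (rule hom_factors_through_H1[OF elementary_2_group_vectors parity_hom]) blast
  then have "coords \<in> hom (H1 G) (vector_group I) \<and> (\<forall>y\<in>carrier G. coords (hurewicz G y) = parity y)"
    unfolding coords_def by (rule someI_ex)
  then show "coords \<in> hom (H1 G) (vector_group I)"
    "y \<in> carrier G \<Longrightarrow> coords (hurewicz G y) = parity y"
    by blast+
qed

lemma coords_in_vectors [simp]: "a \<in> carrier (H1 G) \<Longrightarrow> coords a \<in> vectors I"
  using coords_hom by (auto simp: hom_def)

lemma coords_mult [simp]:
  "a \<in> carrier (H1 G) \<Longrightarrow> b \<in> carrier (H1 G) \<Longrightarrow> coords (a \<otimes>\<^bsub>H1 G\<^esub> b) = coords a + coords b"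
  using coords_hom by (auto simp: hom_def)

text \<open>The inverse of \<open>coords\<close>. Having it as a homomorphism proves at once that the classes of the
  generators span the homology and that \<open>coords\<close> is injective.\<close>

definition of_coords :: "('i \<Rightarrow> bit) \<Rightarrow> 'a set" where
  "of_coords v = finprod (H1 G) (\<lambda>i. if v i = 1 then hurewicz G (u i) else \<one>\<^bsub>H1 G\<^esub>) I"

lemma of_coords_hom: "of_coords \<in> hom (vector_group I) (H1 G)"
proof (rule homI)
  note H = comm_group.axioms(1)[OF comm_group_H1]
  fix v w :: "'i \<Rightarrow> bit"
  have cl: "(\<lambda>i. if v i = 1 then hurewicz G (u i) else \<one>\<^bsub>H1 G\<^esub>) \<in> I \<rightarrow> carrier (H1 G)" for v :: "'i \<Rightarrow> bit"
    using monoid.one_closed[OF group.is_monoid[OF group_H1]] by auto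
  then show "of_coords v \<in> carrier (H1 G)"
    unfolding of_coords_def by (rule comm_monoid.finprod_closed[OF H])
  show "of_coords (v \<otimes>\<^bsub>vector_group I\<^esub> w) = of_coords v \<otimes>\<^bsub>H1 G\<^esub> of_coords w"
    unfolding of_coords_def comm_monoid.finprod_multf[OF H cl cl, symmetric]
  proof (rule comm_monoid.finprod_cong'[OF H])
    fix i assume "i \<in> I"
    then have x: "hurewicz G (u i) \<in> carrier (H1 G)" by simp
    then have "hurewicz G (u i) \<otimes>\<^bsub>H1 G\<^esub> hurewicz G (u i) = \<one>\<^bsub>H1 G\<^esub>"
      using elementary_2_group_H1 by (simp add: elementary_2_group_def)
    with x show "(if (v \<otimes>\<^bsub>vector_group I\<^esub> w) i = 1 then hurewicz G (u i) else \<one>\<^bsub>H1 G\<^esub>) =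
       (if v i = 1 then hurewicz G (u i) else \<one>\<^bsub>H1 G\<^esub>) \<otimes>\<^bsub>H1 G\<^esub> (if w i = 1 then hurewicz G (u i) else \<one>\<^bsub>H1 G\<^esub>)"
      by (cases "v i"; cases "w i") (simp_all add: plus_fun_apply group.is_monoid[OF group_H1] monoid.l_one monoid.r_one)
  qed (use group.is_monoid[OF group_H1] in \<open>auto intro!: monoid.m_closed monoid.one_closed\<close>)
qed

lemma of_coords_closed [simp]: "v \<in> vectors I \<Longrightarrow> of_coords v \<in> carrier (H1 G)"
  using of_coords_hom by (auto simp: hom_def)

lemma of_coords_add: "v \<in> vectors I \<Longrightarrow> w \<in> vectors I \<Longrightarrow> of_coords (v + w) = of_coords v \<otimes>\<^bsub>H1 G\<^esub> of_coords w"
  using of_coords_hom by (auto simp: hom_def)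

lemma of_coords_basis_vector:
  assumes "i \<in> I"
  shows "of_coords (basis_vector i) = hurewicz G (u i)"
proof -
  note H = comm_group.axioms(1)[OF comm_group_H1]
  have "(\<lambda>j. if basis_vector i j = 1 then hurewicz G (u j) else \<one>\<^bsub>H1 G\<^esub>) =
      (\<lambda>j. if i = j then hurewicz G (u j) else \<one>\<^bsub>H1 G\<^esub>)"
    unfolding basis_vector_def by (rule ext) simp
  then have "of_coords (basis_vector i) = finprod (H1 G) (\<lambda>j. if i = j then hurewicz G (u j) else \<one>\<^bsub>H1 G\<^esub>) I"
    unfolding of_coords_def by (rule arg_cong)
  also have "\<dots> = hurewicz G (u i)"
    by (rule comm_monoid.finprod_singleton[OF H assms finite_generators]) simp
  finally show ?thesis .
qed

lemma of_coords_parity [simp]: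
  assumes "y \<in> carrier G"
  shows "of_coords (parity y) = hurewicz G y"
proof -
  have "of_coords \<circ> parity \<in> hom G (H1 G)"
    using parity_hom of_coords_hom by (rule Group.hom_compose)
  then have "(of_coords \<circ> parity) y = hurewicz G y"
    by (rule presentation_hom_unique[OF presentation group_H1 _ hurewicz_hom])
      (simp_all add: assms of_coords_basis_vector)
  then show ?thesis by simp
qed

lemma of_coords_inverse [simp]: "a \<in> carrier (H1 G) \<Longrightarrow> of_coords (coords a) = a"
  by (auto simp: carrier_H1)

lemma coords_inverse [simp]:
  assumes "v \<in> vectors I"
  shows "coords (of_coords v) = v"
  using finite_generators assms
proof (induction v rule: vectors_induct)
  case zero
  then show ?case using of_coords_parity[OF one_closed] by (metis coords_hurewicz one_closed parity_one)
next
  case (add v w)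
  then show ?case by (simp add: of_coords_add)
qed (simp add: of_coords_basis_vector)

lemma H1_induct [consumes 1, case_names one generator mult]:
  assumes "a \<in> carrier (H1 G)"
    and one: "Q \<one>\<^bsub>H1 G\<^esub>"
    and "\<And>i. i \<in> I \<Longrightarrow> Q (hurewicz G (u i))"
    and mult: "\<And>a b. a \<in> carrier (H1 G) \<Longrightarrow> b \<in> carrier (H1 G) \<Longrightarrow> Q a \<Longrightarrow> Q b \<Longrightarrow> Q (a \<otimes>\<^bsub>H1 G\<^esub> b)"
  shows "Q a"
proof -
  have of_zero: "of_coords 0 = \<one>\<^bsub>H1 G\<^esub>"
    by (rule hom_one[OF of_coords_hom group_vectors group_H1, simplified])
  have "Q (of_coords v)" if "v \<in> vectors I" for v
    using finite_generators that
  proof (induction v rule: vectors_induct)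
    case zero
    then show ?case using one of_zero by simp
  qed (use assms in \<open>auto simp: of_coords_basis_vector of_coords_add\<close>)
  from this[of "coords a"] show ?thesis using assms(1) by simp
qed

end

section \<open>The words in the relators\<close>

definition commutator :: "('a, 'c) monoid_scheme \<Rightarrow> 'a \<Rightarrow> 'a \<Rightarrow> 'a" where
  "commutator G a b = a \<otimes>\<^bsub>G\<^esub> b \<otimes>\<^bsub>G\<^esub> inv\<^bsub>G\<^esub> a \<otimes>\<^bsub>G\<^esub> inv\<^bsub>G\<^esub> b"

text \<open>The value of the surface relator of genus \<open>n\<close>.\<close>

fun handle_product :: "('a, 'c) monoid_scheme \<Rightarrow> (nat \<Rightarrow> 'a) \<Rightarrow> nat \<Rightarrow> 'a" where
  "handle_product G v 0 = \<one>\<^bsub>G\<^esub>"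
| "handle_product G v (Suc n) =
     handle_product G v n \<otimes>\<^bsub>G\<^esub> commutator G (v (2 * Suc n - 1)) (v (2 * Suc n))"

definition bundle_relators :: "nat \<Rightarrow> int \<Rightarrow> nat word set" where
  "bundle_relators g q = (\<lambda>i. comm_word i 0) ` {1..2*g} \<union> {surface_relator g @ power_word 0 q}"

lemma surface_relator_Suc:
  "surface_relator (Suc n) = surface_relator n @ comm_word (2 * Suc n - 1) (2 * Suc n)"
  by (simp add: surface_relator_def)

lemma comm_word_in_words: "comm_word i j \<in> words I \<longleftrightarrow> i \<in> I \<and> j \<in> I"
  by (auto simp: comm_word_def)

lemma surface_relator_in_words: "{1..2*n} \<subseteq> I \<Longrightarrow> surface_relator n \<in> words I"
proof (induction n)
  case 0
  then show ?case by (simp add: surface_relator_def)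
next
  case (Suc n)
  then have "{1..2*n} \<subseteq> I" "2 * Suc n - 1 \<in> I" "2 * Suc n \<in> I" by auto
  then show ?case using Suc.IH by (simp add: surface_relator_Suc comm_word_in_words)
qed

lemma power_word_in_words: "i \<in> I \<Longrightarrow> power_word i q \<in> words I"
  by (auto simp: power_word_def words_def)

context group
begin

lemma commutator_closed [simp]: "a \<in> carrier G \<Longrightarrow> b \<in> carrier G \<Longrightarrow> commutator G a b \<in> carrier G"
  by (simp add: commutator_def)

lemma handle_product_closed:
  "v \<in> I \<rightarrow> carrier G \<Longrightarrow> {1..2*n} \<subseteq> I \<Longrightarrow> handle_product G v n \<in> carrier G"
proof (induction n)
  case (Suc n)
  then have "{1..2*n} \<subseteq> I" "2 * Suc n - 1 \<in> I" "2 * Suc n \<in> I" by auto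
  then show ?case using Suc by (auto simp: Pi_def)
qed simp

lemma eval_comm_word:
  "v i \<in> carrier G \<Longrightarrow> v j \<in> carrier G \<Longrightarrow> eval_word G v (comm_word i j) = commutator G (v i) (v j)"
  by (simp add: comm_word_def commutator_def m_assoc)

lemma eval_surface_relator:
  "v \<in> I \<rightarrow> carrier G \<Longrightarrow> {1..2*n} \<subseteq> I \<Longrightarrow> eval_word G v (surface_relator n) = handle_product G v n"
proof (induction n)
  case 0
  then show ?case by (simp add: surface_relator_def)
next
  case (Suc n)
  then have *: "{1..2*n} \<subseteq> I" "2 * Suc n - 1 \<in> I" "2 * Suc n \<in> I" by auto
  then have "v (2 * Suc n - 1) \<in> carrier G" "v (2 * Suc n) \<in> carrier G"
    using Suc.prems(1) by auto
  then show ?case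
    using Suc * eval_word_append[OF Suc.prems(1) surface_relator_in_words[OF *(1)],
        of "comm_word (2 * Suc n - 1) (2 * Suc n)"]
      eval_comm_word[of v "2 * Suc n - 1" "2 * Suc n"]
    by (simp add: surface_relator_Suc comm_word_in_words)
qed

lemma eval_power_word:
  assumes "v i \<in> carrier G"
  shows "eval_word G v (power_word i q) = v i [^] q"
proof -
  have pos: "eval_word G v (replicate n (True, i)) = v i [^] n" for n
    using assms nat_pow_Suc2 by (induction n) simp_all
  have neg: "eval_word G v (replicate n (False, i)) = inv (v i) [^] n" for n
    using assms nat_pow_Suc2 by (induction n) simp_all
  show ?thesis
  proof (cases "q \<ge> 0")
    case True
    then obtain n where "q = int n" by (rule nonneg_int_cases)
    then show ?thesis using pos by (simp add: power_word_def int_pow_int)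
  next
    case False
    then obtain n where n: "q = - int n" "n > 0"
      by (metis neg_int_cases not_le)
    then show ?thesis
      using neg assms by (simp add: power_word_def int_pow_neg_int nat_pow_inv)
  qed
qed

lemma commutator_eq_one_iff:
  assumes "a \<in> carrier G" "b \<in> carrier G"
  shows "commutator G a b = \<one> \<longleftrightarrow> a \<otimes> b = b \<otimes> a"
proof -
  have "commutator G a b = (a \<otimes> b) \<otimes> inv (b \<otimes> a)"
    using assms by (simp add: commutator_def inv_mult_group m_assoc)
  then show ?thesis
    using assms by (metis inv_closed inv_inv inv_equality m_closed r_inv)
qed

lemma handle_product_cong:
  assumes "\<And>l. l \<in> {1..n} \<Longrightarrow>
    commutator G (v (2*l - 1)) (v (2*l)) = commutator G (w (2*l - 1)) (w (2*l))"
  shows "handle_product G v n = handle_product G w n"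
  using assms
proof (induction n)
  case (Suc n)
  have "commutator G (v (2 * Suc n - 1)) (v (2 * Suc n)) = commutator G (w (2 * Suc n - 1)) (w (2 * Suc n))"
    using Suc.prems[of "Suc n"] by simp
  moreover have "handle_product G v n = handle_product G w n"
    using Suc.prems by (intro Suc.IH) auto
  ultimately show ?case by simp
qed simp

text \<open>A twist along a curve that runs through two neighbouring handles changes both commutators and
  preserves their product.\<close>

lemma handle_product_cong_pair:
  assumes "v \<in> {1..2*n} \<rightarrow> carrier G" "w \<in> {1..2*n} \<rightarrow> carrier G" "l \<ge> 1" "Suc l \<le> n"
    and "\<And>m. m \<in> {1..n} - {l, Suc l} \<Longrightarrow>
      commutator G (v (2*m - 1)) (v (2*m)) = commutator G (w (2*m - 1)) (w (2*m))"
    and "commutator G (v (2*l - 1)) (v (2*l)) \<otimes> commutator G (v (2 * Suc l - 1)) (v (2 * Suc l)) =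
      commutator G (w (2*l - 1)) (w (2*l)) \<otimes> commutator G (w (2 * Suc l - 1)) (w (2 * Suc l))"
  shows "handle_product G v n = handle_product G w n"
  using assms(4,1,2,5)
proof (induction n rule: dec_induct)
  case base
  let ?c = "\<lambda>v l. commutator G (v (2*l - 1)) (v (2*l))"
  obtain k where k: "l = Suc k" using assms(3) by (cases l) auto
  have eq: "handle_product G v k = handle_product G w k"
    using base.prems(3) k by (intro handle_product_cong) auto
  have cl: "handle_product G x k \<in> carrier G" "?c x l \<in> carrier G" "?c x (Suc l) \<in> carrier G"
    if "x \<in> {1..2 * Suc l} \<rightarrow> carrier G" for x
    using that handle_product_closed[OF that, of k] k assms(3)
    by (auto simp: Pi_def intro!: commutator_closed)
  have "handle_product G x (Suc l) = handle_product G x k \<otimes> (?c x l \<otimes> ?c x (Suc l))"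
    if "x \<in> {1..2 * Suc l} \<rightarrow> carrier G" for x
    using cl[OF that] k by (simp add: m_assoc)
  then show ?case
    using base.prems(1,2) eq assms(6) by simp
next
  case (step n)
  have "commutator G (v (2 * Suc n - 1)) (v (2 * Suc n)) = commutator G (w (2 * Suc n - 1)) (w (2 * Suc n))"
    using step.prems(3)[of "Suc n"] step.hyps by simp
  moreover have "handle_product G v n = handle_product G w n"
    using step.prems by (intro step.IH) auto
  ultimately show ?case by simp
qed

lemma handle_product_trivial:
  assumes "\<And>a b. a \<in> carrier G \<Longrightarrow> b \<in> carrier G \<Longrightarrow> a \<otimes> b = b \<otimes> a"
    "v \<in> I \<rightarrow> carrier G" "{1..2*n} \<subseteq> I"
  shows "handle_product G v n = \<one>"
  using assms(3)
proof (induction n)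
  case (Suc n)
  then have *: "{1..2*n} \<subseteq> I" "2 * Suc n - 1 \<in> I" "2 * Suc n \<in> I" by auto
  then have "v (2 * Suc n - 1) \<in> carrier G" "v (2 * Suc n) \<in> carrier G"
    using assms(2) by auto
  then have "commutator G (v (2 * Suc n - 1)) (v (2 * Suc n)) = \<one>"
    using assms(1) by (simp add: commutator_eq_one_iff)
  then show ?case using Suc.IH * by simp
qed simp

end

lemma vector_group_int_pow:
  assumes "v \<in> vectors I"
  shows "v [^]\<^bsub>vector_group I\<^esub> (z :: int) = (if odd z then v else 0)"
proof -
  interpret group "vector_group I" by (rule group_vectors)
  have even: "v [^]\<^bsub>vector_group I\<^esub> (2 * k) = 0" for k :: int
    using int_pow_mult[of v k k] assms by (simp flip: mult_2)
  show ?thesis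
  proof (cases "even z")
    case True
    then show ?thesis using even by (auto elim!: evenE)
  next
    case False
    then obtain k where "z = 2 * k + 1" by (rule oddE)
    then show ?thesis using even[of k] int_pow_mult[of v "2*k" 1] assms by simp
  qed
qed

lemma bundle_relators_even:
  assumes "even q" "r \<in> bundle_relators g q"
  shows "eval_word (vector_group {0..2*g}) basis_vector r = 0"
proof -
  let ?V = "vector_group {0..2*g}"
  interpret V: group ?V by (rule group_vectors)
  have comm: "x \<otimes>\<^bsub>?V\<^esub> y = y \<otimes>\<^bsub>?V\<^esub> x" for x y
    by (simp add: add.commute)
  have b: "basis_vector \<in> {0..2*g} \<rightarrow> carrier ?V" by auto
  have r1: "eval_word ?V basis_vector (comm_word i 0) = \<one>\<^bsub>?V\<^esub>" if "i \<in> {1..2*g}" for i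
  proof -
    have "commutator ?V (basis_vector i) (basis_vector 0) = \<one>\<^bsub>?V\<^esub>"
      using that comm by (subst V.commutator_eq_one_iff) auto
    then show ?thesis using that by (subst V.eval_comm_word) auto
  qed
  have "eval_word ?V basis_vector (surface_relator g @ power_word 0 q) =
      handle_product ?V basis_vector g \<otimes>\<^bsub>?V\<^esub> basis_vector 0 [^]\<^bsub>?V\<^esub> q"
    using V.eval_word_append[OF b surface_relator_in_words power_word_in_words, of g 0 q]
      V.eval_surface_relator[OF b, of g] V.eval_power_word[of basis_vector 0 q] by auto
  moreover have "handle_product ?V basis_vector g = \<one>\<^bsub>?V\<^esub>"
    using V.handle_product_trivial[OF comm b] by auto
  moreover have "basis_vector 0 [^]\<^bsub>?V\<^esub> q = \<one>\<^bsub>?V\<^esub>"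
    using assms(1) by (subst vector_group_int_pow) auto
  ultimately show ?thesis
    using assms(2) r1 by (auto simp: bundle_relators_def)
qed

lemma surface_relator_even:
  assumes "r \<in> {surface_relator g}"
  shows "eval_word (vector_group {1..2*g}) basis_vector r = 0"
proof -
  let ?V = "vector_group {1..2*g}"
  interpret V: group ?V by (rule group_vectors)
  have comm: "x \<otimes>\<^bsub>?V\<^esub> y = y \<otimes>\<^bsub>?V\<^esub> x" for x y
    by (simp add: add.commute)
  have b: "basis_vector \<in> {1..2*g} \<rightarrow> carrier ?V" by auto
  show ?thesis
    using assms V.eval_surface_relator[OF b, of g] V.handle_product_trivial[OF comm b] by auto
qed

section \<open>Automorphisms of the group of a circle bundle\<close>

locale circle_bundle = group P for P :: "('b, 'd) monoid_scheme" (structure) +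
  fixes g :: nat and q :: int and u :: "nat \<Rightarrow> 'b"
  assumes bundle_group: "circle_bundle_group g q P u"
    and even_chern: "even q"
begin

sublocale even_presentation P "{0..2*g}" u "bundle_relators g q"
proof
  show "has_presentation P {0..2*g} u (bundle_relators g q)"
    using bundle_group by (simp add: circle_bundle_group_def bundle_relators_def)
qed (use bundle_relators_even[OF even_chern] in auto)

lemma generators_funcset: "u \<in> {0..2*g} \<rightarrow> carrier P"
  by auto

lemma fibre_closed [simp]: "u 0 \<in> carrier P"
  by simp

lemma bundle_relation: "handle_product P u g \<otimes> u 0 [^] q = \<one>"
proof -
  have "eval_word P u (surface_relator g @ power_word 0 q) = \<one>"
    by (rule presentation_relator[OF presentation])
      (auto simp: bundle_relators_def surface_relator_in_words power_word_in_words)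
  then show ?thesis
    using eval_word_append[OF generators_funcset surface_relator_in_words power_word_in_words, of g 0 q]
      eval_surface_relator[OF generators_funcset, of g] eval_power_word[of u 0 q] by auto
qed

lemma bundle_universal:
  assumes "group H" "v \<in> {0..2*g} \<rightarrow> carrier H"
    and "\<And>i. i \<in> {1..2*g} \<Longrightarrow> v i \<otimes>\<^bsub>H\<^esub> v 0 = v 0 \<otimes>\<^bsub>H\<^esub> v i"
    and "handle_product H v g \<otimes>\<^bsub>H\<^esub> v 0 [^]\<^bsub>H\<^esub> q = \<one>\<^bsub>H\<^esub>"
  obtains h where "h \<in> hom P H" "\<And>i. i \<in> {0..2*g} \<Longrightarrow> h (u i) = v i"
proof (rule presentation_universal[OF presentation assms(1,2)])
  interpret H: group H by fact
  fix r assume "r \<in> bundle_relators g q"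
  then consider i where "i \<in> {1..2*g}" "r = comm_word i 0" | "r = surface_relator g @ power_word 0 q"
    by (auto simp: bundle_relators_def)
  then show "eval_word H v r = \<one>\<^bsub>H\<^esub>"
  proof cases
    case 1
    then have "v i \<in> carrier H" "v 0 \<in> carrier H" using assms(2) by auto
    then show ?thesis
      using 1 assms(3) by (simp add: H.eval_comm_word H.commutator_eq_one_iff)
  next
    case 2
    have "v 0 \<in> carrier H" using assms(2) by auto
    then show ?thesis
      using 2 assms(4) H.eval_word_append[OF assms(2) surface_relator_in_words power_word_in_words, of g 0 q]
        H.eval_surface_relator[OF assms(2), of g] H.eval_power_word[of v 0 q] by auto
  qed
qed (rule that)

text \<open>Conjugation by \<open>u 0\<close> is a homomorphism that agrees with the identity on the generators.\<close>

lemma fibre_central: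
  assumes "y \<in> carrier P"
  shows "u 0 \<otimes> y = y \<otimes> u 0"
proof -
  have "u i \<otimes> u 0 = u 0 \<otimes> u i" if "i \<in> {0..2*g}" for i
  proof (cases "i = 0")
    case False
    then have "eval_word P u (comm_word i 0) = \<one>"
      using that by (intro presentation_relator[OF presentation]) (auto simp: bundle_relators_def comm_word_in_words)
    then show ?thesis using that by (simp add: eval_comm_word commutator_eq_one_iff)
  qed simp
  then have "u 0 \<otimes> u i \<otimes> inv (u 0) = u i" if "i \<in> {0..2*g}" for i
    using that by (metis generator_closed fibre_closed inv_closed m_assoc r_inv r_one)
  moreover have "(\<lambda>y. u 0 \<otimes> y \<otimes> inv (u 0)) \<in> hom P P" "(\<lambda>y. y) \<in> hom P P"
    by (auto intro!: homI simp: m_assoc)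
  ultimately have "u 0 \<otimes> y \<otimes> inv (u 0) = y"
    using presentation_hom_unique[OF presentation is_group, of "\<lambda>y. u 0 \<otimes> y \<otimes> inv (u 0)" "\<lambda>y. y"] assms
    by blast
  then have "u 0 \<otimes> y \<otimes> inv (u 0) \<otimes> u 0 = y \<otimes> u 0"
    by simp
  then show ?thesis using assms by (simp add: m_assoc)
qed

lemma endomorphism_exists:
  assumes "v \<in> {0..2*g} \<rightarrow> carrier P" "v 0 = u 0" "handle_product P v g = handle_product P u g"
  obtains h where "h \<in> hom P P" "\<And>i. i \<in> {0..2*g} \<Longrightarrow> h (u i) = v i"
proof (rule bundle_universal[OF is_group assms(1)])
  show "v i \<otimes> v 0 = v 0 \<otimes> v i" if "i \<in> {1..2*g}" for i
    using fibre_central[OF funcset_mem[OF assms(1), of i]] assms(2) that by simp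
  show "handle_product P v g \<otimes> v 0 [^] q = \<one>"
    using assms bundle_relation by simp
qed (rule that)

text \<open>For suitable exponents these are the images of the generators under a Dehn twist along a curve
  representing \<open>d\<close>: a generator picks up \<open>d\<close> or its inverse where it crosses that curve.\<close>

definition twist :: "(nat \<Rightarrow> int) \<Rightarrow> (nat \<Rightarrow> int) \<Rightarrow> 'b \<Rightarrow> nat \<Rightarrow> 'b" where
  "twist \<alpha> \<beta> d i = d [^] \<alpha> i \<otimes> u i \<otimes> d [^] \<beta> i"

text \<open>A twist fixes the curve along which it twists, so multiplying the generators by powers of the
  inverse of \<open>c\<close> undoes it. The assumptions are the same for \<open>c\<close> and its inverse, and together they
  provide both the endomorphism and its inverse.\<close>

lemma twist_automorphism:
  assumes "c \<in> carrier P" "\<alpha> 0 = 0" "\<beta> 0 = 0"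
    and relation: "\<And>d. d \<in> {c, inv c} \<Longrightarrow> handle_product P (twist \<alpha> \<beta> d) g = handle_product P u g"
    and curve_fixed: "\<And>d h. d \<in> {c, inv c} \<Longrightarrow> h \<in> hom P P \<Longrightarrow>
      (\<And>i. i \<in> {0..2*g} \<Longrightarrow> h (u i) = twist \<alpha> \<beta> d i) \<Longrightarrow> h c = c"
  obtains k where "k \<in> auto P" "\<And>i. i \<in> {0..2*g} \<Longrightarrow> k (u i) = twist \<alpha> \<beta> c i"
proof -
  have ex: "\<exists>h \<in> hom P P. \<forall>i\<in>{0..2*g}. h (u i) = twist \<alpha> \<beta> d i" if d: "d \<in> {c, inv c}" for d
  proof -
    have cl: "twist \<alpha> \<beta> d \<in> {0..2*g} \<rightarrow> carrier P"
      using d assms(1) by (auto simp: twist_def)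
    have "twist \<alpha> \<beta> d 0 = u 0"
      using assms(2,3) by (simp add: twist_def)
    from endomorphism_exists[OF cl this relation[OF d]] show ?thesis by metis
  qed
  obtain h where h: "h \<in> hom P P" "\<And>i. i \<in> {0..2*g} \<Longrightarrow> h (u i) = twist \<alpha> \<beta> c i"
    using ex[of c] by auto
  obtain h' where h': "h' \<in> hom P P" "\<And>i. i \<in> {0..2*g} \<Longrightarrow> h' (u i) = twist \<alpha> \<beta> (inv c) i"
    using ex[of "inv c"] by auto
  interpret h: group_hom P P h by unfold_locales (rule h(1))
  interpret h': group_hom P P h' by unfold_locales (rule h'(1))
  have c: "h c = c" "h' c = c"
    using curve_fixed[OF _ h] curve_fixed[OF _ h'] by auto
  have inverse: "inv c [^] z = inv (c [^] z)" for z :: int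
    using assms(1) by (rule int_pow_inv)
  have 1: "h' (h (u i)) = u i" "h (h' (u i)) = u i" if "i \<in> {0..2*g}" for i
  proof -
    have [simp]: "u i \<in> carrier P" using that by auto
    note hi = h(2)[OF that] and h'i = h'(2)[OF that]
    show "h' (h (u i)) = u i"
      unfolding hi using assms(1) c h'i by (simp add: twist_def inverse h'.hom_int_pow m_assoc)
    show "h (h' (u i)) = u i"
      unfolding h'i using assms(1) c hi by (simp add: twist_def inverse h.hom_int_pow m_assoc)
  qed
  have comp: "h' \<circ> h \<in> hom P P" "h \<circ> h' \<in> hom P P"
    using Group.hom_compose[OF h(1) h'(1)] Group.hom_compose[OF h'(1) h(1)] by simp_all
  have id: "(\<lambda>y. y) \<in> hom P P" by (simp add: hom_def)
  have 2: "(h' \<circ> h) y = y" "(h \<circ> h') y = y" if "y \<in> carrier P" for y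
    using presentation_hom_unique[OF presentation is_group comp(1) id _ that]
      presentation_hom_unique[OF presentation is_group comp(2) id _ that] 1 by auto
  have "bij_betw h (carrier P) (carrier P)"
    by (rule bij_betw_byWitness[where f' = h']) (use 2 in auto)
  then have "restrict h (carrier P) \<in> auto P"
    by (auto simp: auto_def Bij_def hom_def)
  moreover have "restrict h (carrier P) (u i) = twist \<alpha> \<beta> c i" if "i \<in> {0..2*g}" for i
    using that h(2) by auto
  ultimately show thesis by (rule that)
qed

lemma twist_parity:
  assumes "c \<in> carrier P" "i \<in> {0..2*g}"
  shows "parity (twist \<alpha> \<beta> c i) = basis_vector i + (if odd (\<alpha> i + \<beta> i) then parity c else 0)"
proof -
  have "parity (c [^] z) = (if odd z then parity c else 0)" for z :: int
    using hom_int_pow[OF parity_hom assms(1) is_group group_vectors, of z]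
      vector_group_int_pow[of "parity c" "{0..2*g}" z] assms(1) by simp
  then show ?thesis
    using assms by (auto simp: twist_def add_ac)
qed

text \<open>The coordinate 0 belongs to the fibre. Clearing it is the projection from the homology of the bundle
  to that of the surface.\<close>

definition surface_part :: "(nat \<Rightarrow> bit) \<Rightarrow> nat \<Rightarrow> bit" where
  "surface_part v = v(0 := 0)"

lemma surface_part_simps [simp]:
  "surface_part (v + w) = surface_part v + surface_part w"
  "surface_part 0 = 0"
  "surface_part (basis_vector 0) = 0"
  "i > 0 \<Longrightarrow> surface_part (basis_vector i) = basis_vector i"
  "v \<in> vectors {0..2*g} \<Longrightarrow> surface_part v \<in> vectors {1..2*g}"
  by (auto simp: surface_part_def basis_vector_def fun_eq_iff plus_fun_apply zero_fun_apply vectors_def)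

lemma surface_part_eqD:
  assumes "surface_part v = surface_part w"
  shows "v = w \<or> v = w + basis_vector 0"
proof (cases "v 0 = w 0")
  case True
  have "v j = w j" for j
    using True fun_cong[OF assms, of j] by (cases "j = 0") (auto simp: surface_part_def)
  then show ?thesis by auto
next
  case False
  have "v j = (w + basis_vector 0) j" for j
    using False fun_cong[OF assms, of j]
    by (cases "j = 0"; cases "v 0"; cases "w 0") (auto simp: surface_part_def basis_vector_def plus_fun_apply)
  then show ?thesis by auto
qed

declare surface_part_simps(5) [simplified, simp]

text \<open>The automorphism is only prescribed modulo the class of the fibre, which the twists in the fibre
  direction can correct afterwards.\<close>

definition realised :: "((nat \<Rightarrow> bit) \<Rightarrow> (nat \<Rightarrow> bit)) \<Rightarrow> bool" where
  "realised L \<longleftrightarrow> (\<exists>k \<in> auto P. k (u 0) = u 0 \<and>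
     (\<forall>y \<in> carrier P. surface_part (parity (k y)) = L (surface_part (parity y))))"

lemma realised_cong:
  assumes "realised L" "\<And>v. v \<in> vectors {1..2*g} \<Longrightarrow> L v = M v"
  shows "realised M"
  using assms unfolding realised_def by (metis parity_in_vectors surface_part_simps(5))

lemma auto_closed: "k \<in> auto P \<Longrightarrow> y \<in> carrier P \<Longrightarrow> k y \<in> carrier P"
  by (auto simp: auto_def hom_def)

lemma auto_compose:
  assumes "k \<in> auto P" "k' \<in> auto P"
  shows "compose (carrier P) k k' \<in> auto P"
  using assms by (auto simp: auto_def compose_Bij intro: hom_compose)

lemma realised_compose:
  assumes "realised L" "realised M"
  shows "realised (L \<circ> M)"
proof -
  obtain k where k: "k \<in> auto P" "k (u 0) = u 0"
    "\<And>y. y \<in> carrier P \<Longrightarrow> surface_part (parity (k y)) = L (surface_part (parity y))"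
    using assms(1) unfolding realised_def by blast
  obtain k' where k': "k' \<in> auto P" "k' (u 0) = u 0"
    "\<And>y. y \<in> carrier P \<Longrightarrow> surface_part (parity (k' y)) = M (surface_part (parity y))"
    using assms(2) unfolding realised_def by blast
  show ?thesis
    unfolding realised_def
  proof (intro bexI conjI ballI)
    show "compose (carrier P) k k' \<in> auto P" by (rule auto_compose[OF k(1) k'(1)])
  qed (use k k' auto_closed in \<open>simp_all add: compose_eq\<close>)
qed

lemma realised_identity: "realised (\<lambda>v. v)"
  unfolding realised_def by (rule bexI[OF _ id_in_auto]) auto

lemma realised_on_generators:
  assumes "k \<in> auto P" "k (u 0) = u 0"
    and L: "\<And>v. v \<in> vectors {1..2*g} \<Longrightarrow> L v \<in> vectors {1..2*g}"
      "\<And>v w. v \<in> vectors {1..2*g} \<Longrightarrow> w \<in> vectors {1..2*g} \<Longrightarrow> L (v + w) = L v + L w"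
    and gen: "\<And>i. i \<in> {1..2*g} \<Longrightarrow> surface_part (parity (k (u i))) = L (basis_vector i)"
  shows "realised L"
proof -
  let ?V = "vector_group {1..2*g}"
  have k: "k (y \<otimes> z) = k y \<otimes> k z" "k y \<in> carrier P" if "y \<in> carrier P" "z \<in> carrier P" for y z
    using assms(1) that by (auto simp: auto_def hom_def)
  have "L 0 = 0" using L(2)[of 0 0] by simp
  have "surface_part (parity (k y)) = L (surface_part (parity y))" if y: "y \<in> carrier P" for y
  proof (rule presentation_hom_unique[OF presentation group_vectors _ _ _ y])
    show "(\<lambda>y. surface_part (parity (k y))) \<in> hom P ?V"
      by (rule homI) (simp_all add: k)
    show "(\<lambda>y. L (surface_part (parity y))) \<in> hom P ?V"
      by (rule homI) (simp_all add: L L(1)[simplified])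
    show "surface_part (parity (k (u i))) = L (surface_part (parity (u i)))" if "i \<in> {0..2*g}" for i
      using gen[of i] \<open>L 0 = 0\<close> assms(2) that by (cases "i = 0") auto
  qed
  then show ?thesis using assms(1,2) unfolding realised_def by blast
qed

text \<open>The parity of the exponents has to match the products with \<open>c\<close>: then the twist adds the class of \<open>c\<close>
  to exactly those generators which meet it an odd number of times.\<close>

lemma twist_realises_transvection:
  assumes "c \<in> carrier P" "\<alpha> 0 = 0" "\<beta> 0 = 0"
    and "\<And>d. d \<in> {c, inv c} \<Longrightarrow> handle_product P (twist \<alpha> \<beta> d) g = handle_product P u g"
    and "\<And>d h. d \<in> {c, inv c} \<Longrightarrow> h \<in> hom P P \<Longrightarrow>
      (\<And>i. i \<in> {0..2*g} \<Longrightarrow> h (u i) = twist \<alpha> \<beta> d i) \<Longrightarrow> h c = c"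
    and exponent: "\<And>i. i \<in> {1..2*g} \<Longrightarrow>
      odd (\<alpha> i + \<beta> i) \<longleftrightarrow> omega g (basis_vector i) (surface_part (parity c)) = 1"
  shows "realised (transvection g (surface_part (parity c)))"
proof -
  have "\<exists>k. k \<in> auto P \<and> (\<forall>i\<in>{0..2*g}. k (u i) = twist \<alpha> \<beta> c i)"
  proof (rule twist_automorphism[of c \<alpha> \<beta>, OF assms(1-3)])
    show "handle_product P (twist \<alpha> \<beta> d) g = handle_product P u g" if "d \<in> {c, inv c}" for d
      using that by (rule assms(4))
    show "h c = c" if "d \<in> {c, inv c}" "h \<in> hom P P"
      "\<And>i. i \<in> {0..2*g} \<Longrightarrow> h (u i) = twist \<alpha> \<beta> d i" for d h
      using that by (rule assms(5))
  qed blast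
  then obtain k where k: "k \<in> auto P" "\<And>i. i \<in> {0..2*g} \<Longrightarrow> k (u i) = twist \<alpha> \<beta> c i"
    by blast
  let ?c = "surface_part (parity c)"
  have c: "?c \<in> vectors {1..2*g}" using assms(1) by simp
  show ?thesis
  proof (rule realised_on_generators[OF k(1)])
    show "k (u 0) = u 0" using k(2)[of 0] assms(2,3) by (simp add: twist_def)
    show "transvection g ?c v \<in> vectors {1..2*g}" if "v \<in> vectors {1..2*g}" for v
      using that c by (simp add: transvection_def)
    show "transvection g ?c (v + w) = transvection g ?c v + transvection g ?c w" for v w
      by (rule transvection_add)
    show "surface_part (parity (k (u i))) = transvection g ?c (basis_vector i)" if "i \<in> {1..2*g}" for i
      using that k(2)[of i] twist_parity[OF assms(1), of i] exponent[OF that]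
      by (auto simp: transvection_def)
  qed
qed

text \<open>The twist along \<open>a\<^sub>l\<close> is \<open>b\<^sub>l \<mapsto> b\<^sub>l a\<^sub>l\<close>, which preserves the commutator because \<open>a\<^sub>l\<close> commutes with its
  own powers.\<close>

lemma realised_transvection_a:
  assumes "l \<in> {1..g}"
  shows "realised (transvection g (handle_a l))"
proof -
  have ne: "2*m - 1 \<noteq> 2*l" "2*m = 2*l \<longleftrightarrow> m = l" if "m \<ge> 1" for m :: nat
    using assms that by auto presburger
  let ?a = "u (2*l - 1)" and ?b = "u (2*l)"
  let ?\<beta> = "(\<lambda>i. 0)(2*l := 1 :: int)"
  have cl: "?a \<in> carrier P" "?b \<in> carrier P" using assms by auto
  have "realised (transvection g (surface_part (parity ?a)))"
  proof (rule twist_realises_transvection[of _ "\<lambda>i. 0" ?\<beta>])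
    fix d assume d: "d \<in> {?a, inv ?a}"
    have da: "d \<in> carrier P" "d \<otimes> ?a = ?a \<otimes> d" using d cl by auto
    then have da': "d \<otimes> inv ?a \<otimes> inv d = inv ?a"
      using d cl by (auto simp: m_assoc)
    show "handle_product P (twist (\<lambda>i. 0) ?\<beta> d) g = handle_product P u g"
    proof (rule handle_product_cong)
      fix m assume m: "m \<in> {1..g}"
      then have um: "u (2*m - 1) \<in> carrier P" "u (2*m) \<in> carrier P" by auto
      show "commutator P (twist (\<lambda>i. 0) ?\<beta> d (2*m - 1)) (twist (\<lambda>i. 0) ?\<beta> d (2*m)) =
        commutator P (u (2*m - 1)) (u (2*m))"
      proof (cases "m = l")
        case True
        have "commutator P ?a (?b \<otimes> d) = ?a \<otimes> ?b \<otimes> (d \<otimes> inv ?a \<otimes> inv d) \<otimes> inv ?b"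
          using cl da(1) by (simp add: commutator_def inv_mult_group m_assoc)
        then show ?thesis using True ne[of m] m cl da(1) da' by (simp add: twist_def commutator_def)
      next
        case False
        then show ?thesis using ne[of m] m um by (simp add: twist_def)
      qed
    qed
    fix h assume h: "h \<in> hom P P" "\<And>i. i \<in> {0..2*g} \<Longrightarrow> h (u i) = twist (\<lambda>i. 0) ?\<beta> d i"
    have "2*l - 1 \<in> {0..2*g}" using assms by auto
    from h(2)[OF this] show "h ?a = ?a"
      using ne[of l] assms cl by (simp add: twist_def)
  next
    fix i assume i: "i \<in> {1..2*g}"
    have "omega g (basis_vector i) (handle_a l) = basis_vector i (2*l)" using assms by (rule omega_handle)
    then show "odd ((\<lambda>i. 0) i + ?\<beta> i) \<longleftrightarrow> omega g (basis_vector i) (surface_part (parity ?a)) = 1"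
      using assms by (auto simp: handle_a_def basis_vector_def[of i])
  qed (use assms in auto)
  moreover have "surface_part (parity ?a) = handle_a l"
  proof -
    have i: "2*l - 1 \<in> {0..2*g}" "2*l - 1 > 0" using assms by auto
    show ?thesis unfolding parity_generator[OF i(1)] surface_part_simps(4)[OF i(2)] handle_a_def ..
  qed
  ultimately show ?thesis by simp
qed

text \<open>The twist along \<open>b\<^sub>l\<close> is \<open>a\<^sub>l \<mapsto> a\<^sub>l b\<^sub>l\<close>.\<close>

lemma realised_transvection_b:
  assumes "l \<in> {1..g}"
  shows "realised (transvection g (handle_b l))"
proof -
  have ne: "2*m \<noteq> 2*l - 1" "2*m - 1 = 2*l - 1 \<longleftrightarrow> m = l" if "m \<ge> 1" for m :: nat
    using assms that by auto presburger
  let ?a = "u (2*l - 1)" and ?b = "u (2*l)"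
  let ?\<beta> = "(\<lambda>i. 0)(2*l - 1 := 1 :: int)"
  have cl: "?a \<in> carrier P" "?b \<in> carrier P" using assms by auto
  have "realised (transvection g (surface_part (parity ?b)))"
  proof (rule twist_realises_transvection[of _ "\<lambda>i. 0" ?\<beta>])
    fix d assume d: "d \<in> {?b, inv ?b}"
    have db: "d \<in> carrier P" "d \<otimes> ?b \<otimes> inv d = ?b" using d cl by (auto simp: m_assoc)
    show "handle_product P (twist (\<lambda>i. 0) ?\<beta> d) g = handle_product P u g"
    proof (rule handle_product_cong)
      fix m assume m: "m \<in> {1..g}"
      then have um: "u (2*m - 1) \<in> carrier P" "u (2*m) \<in> carrier P" by auto
      show "commutator P (twist (\<lambda>i. 0) ?\<beta> d (2*m - 1)) (twist (\<lambda>i. 0) ?\<beta> d (2*m)) =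
        commutator P (u (2*m - 1)) (u (2*m))"
      proof (cases "m = l")
        case True
        have "commutator P (?a \<otimes> d) ?b = ?a \<otimes> (d \<otimes> ?b \<otimes> inv d) \<otimes> inv ?a \<otimes> inv ?b"
          using cl db(1) by (simp add: commutator_def inv_mult_group m_assoc)
        then show ?thesis using True ne[of m] m cl db by (simp add: twist_def commutator_def)
      next
        case False
        then show ?thesis using ne[of m] m um by (simp add: twist_def)
      qed
    qed
    fix h assume h: "h \<in> hom P P" "\<And>i. i \<in> {0..2*g} \<Longrightarrow> h (u i) = twist (\<lambda>i. 0) ?\<beta> d i"
    show "h ?b = ?b"
      using h(2)[of "2*l"] ne[of l] assms cl by (simp add: twist_def)
  next
    fix i assume i: "i \<in> {1..2*g}"
    have "omega g (basis_vector i) (handle_b l) = basis_vector i (2*l - 1)" using assms by (rule omega_handle)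
    then show "odd ((\<lambda>i. 0) i + ?\<beta> i) \<longleftrightarrow> omega g (basis_vector i) (surface_part (parity ?b)) = 1"
      using assms by (auto simp: handle_b_def basis_vector_def[of i])
  qed (use assms in auto)
  then show ?thesis using assms by (simp add: handle_b_def)
qed

end

context group
begin

text \<open>The curve \<open>c = b a\<^sup>-\<^sup>1 b\<^sup>-\<^sup>1 a'\<close> joins two neighbouring handles and is homologous to \<open>a + a'\<close> modulo 2. The
  product of the two commutators is \<open>a c b' a'\<^sup>-\<^sup>1 b'\<^sup>-\<^sup>1\<close>, so \<open>c\<close> may be conjugated by any \<open>d\<close> that commutes
  with it, which amounts to \<open>b \<mapsto> d b\<close>, \<open>a' \<mapsto> d a' d\<^sup>-\<^sup>1\<close> and \<open>b' \<mapsto> b' d\<^sup>-\<^sup>1\<close>.\<close>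

lemma adjacent_twist_curve:
  assumes "a \<in> carrier G" "b \<in> carrier G" "a' \<in> carrier G" "d \<in> carrier G"
    and "d \<otimes> (b \<otimes> inv a \<otimes> inv b \<otimes> a') = (b \<otimes> inv a \<otimes> inv b \<otimes> a') \<otimes> d"
  shows "(d \<otimes> b) \<otimes> inv a \<otimes> inv (d \<otimes> b) \<otimes> (d \<otimes> a' \<otimes> inv d) = b \<otimes> inv a \<otimes> inv b \<otimes> a'"
proof -
  have "(d \<otimes> b) \<otimes> inv a \<otimes> inv (d \<otimes> b) \<otimes> (d \<otimes> a' \<otimes> inv d) =
      (d \<otimes> (b \<otimes> inv a \<otimes> inv b \<otimes> a')) \<otimes> inv d"
    using assms(1-4) by (simp add: inv_mult_group m_assoc)
  also have "\<dots> = b \<otimes> inv a \<otimes> inv b \<otimes> a'"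
    unfolding assms(5) using assms(1-4) by (simp add: m_assoc)
  finally show ?thesis .
qed

lemma adjacent_twist_relation:
  assumes "a \<in> carrier G" "b \<in> carrier G" "a' \<in> carrier G" "b' \<in> carrier G" "d \<in> carrier G"
    and "d \<otimes> (b \<otimes> inv a \<otimes> inv b \<otimes> a') = (b \<otimes> inv a \<otimes> inv b \<otimes> a') \<otimes> d"
  shows "commutator G a (d \<otimes> b) \<otimes> commutator G (d \<otimes> a' \<otimes> inv d) (b' \<otimes> inv d) =
    commutator G a b \<otimes> commutator G a' b'"
proof -
  have "commutator G a (d \<otimes> b) \<otimes> commutator G (d \<otimes> a' \<otimes> inv d) (b' \<otimes> inv d) =
      a \<otimes> ((d \<otimes> (b \<otimes> inv a \<otimes> inv b \<otimes> a')) \<otimes> inv d) \<otimes> b' \<otimes> inv a' \<otimes> inv b'"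
    using assms(1-5) by (simp add: commutator_def inv_mult_group m_assoc)
  also have "\<dots> = commutator G a b \<otimes> commutator G a' b'"
    unfolding assms(6) using assms(1-5) by (simp add: commutator_def m_assoc)
  finally show ?thesis .
qed

lemma commutator_mult_central:
  assumes "a \<in> carrier G" "b \<in> carrier G" "z \<in> carrier G" "w \<in> carrier G"
    and "\<And>y. y \<in> carrier G \<Longrightarrow> z \<otimes> y = y \<otimes> z" "\<And>y. y \<in> carrier G \<Longrightarrow> w \<otimes> y = y \<otimes> w"
  shows "commutator G (a \<otimes> z) (b \<otimes> w) = commutator G a b"
proof -
  let ?y = "b \<otimes> w"
  have "commutator G (a \<otimes> z) ?y = a \<otimes> (z \<otimes> ?y) \<otimes> inv z \<otimes> inv a \<otimes> inv ?y"
    using assms(1-4) by (simp add: commutator_def inv_mult_group m_assoc)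
  also have "\<dots> = a \<otimes> b \<otimes> (w \<otimes> inv a) \<otimes> inv w \<otimes> inv b"
    unfolding assms(5)[OF m_closed[OF assms(2,4)]]
    using assms(1-4) by (simp add: inv_mult_group m_assoc)
  also have "\<dots> = commutator G a b"
    unfolding assms(6)[OF inv_closed[OF assms(1)]]
    using assms(1-4) by (simp add: commutator_def m_assoc)
  finally show ?thesis .
qed

end

context circle_bundle
begin

text \<open>With exponents \<open>1\<close> on the left of \<open>b\<^sub>l\<close>, \<open>1\<close> and \<open>-1\<close> on the two sides of \<open>a\<^sub>l\<^sub>+\<^sub>1\<close>, and \<open>-1\<close> on the right
  of \<open>b\<^sub>l\<^sub>+\<^sub>1\<close>, only \<open>b\<^sub>l\<close> and \<open>b\<^sub>l\<^sub>+\<^sub>1\<close> change in homology.\<close>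

lemma realised_transvection_adjacent:
  assumes "l \<in> {1..g}" "Suc l \<in> {1..g}"
  shows "realised (transvection g (handle_a l + handle_a (Suc l)))"
proof -
  let ?i1 = "2*l - 1" and ?i2 = "2*l" and ?i3 = "Suc (2*l)" and ?i4 = "Suc (Suc (2*l))"
  let ?a = "u ?i1" and ?b = "u ?i2" and ?a' = "u ?i3" and ?b' = "u ?i4"
  let ?c = "?b \<otimes> inv ?a \<otimes> inv ?b \<otimes> ?a'"
  let ?\<alpha> = "(\<lambda>i. 0)(?i2 := 1, ?i3 := 1 :: int)" and ?\<beta> = "(\<lambda>i. 0)(?i3 := -1, ?i4 := -1 :: int)"
  have i4: "2 * Suc l - 1 = ?i3" "2 * Suc l = ?i4" "?i4 - 1 = ?i3" by simp_all
  have ne: "?i1 \<noteq> ?i2" "?i1 \<noteq> ?i3" "?i1 \<noteq> ?i4" using assms by auto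
  have mem: "?i1 \<in> {0..2*g}" "?i2 \<in> {0..2*g}" "?i3 \<in> {0..2*g}" "?i4 \<in> {0..2*g}" using assms by auto
  then have cl: "?a \<in> carrier P" "?b \<in> carrier P" "?a' \<in> carrier P" "?b' \<in> carrier P"
    by (simp_all del: atLeastAtMost_iff)
  have tw: "twist ?\<alpha> ?\<beta> d ?i1 = ?a" "twist ?\<alpha> ?\<beta> d ?i2 = d \<otimes> ?b"
    "twist ?\<alpha> ?\<beta> d ?i3 = d \<otimes> ?a' \<otimes> inv d" "twist ?\<alpha> ?\<beta> d ?i4 = ?b' \<otimes> inv d"
    if "d \<in> carrier P" for d
    unfolding twist_def using that cl ne by (simp_all add: int_pow_neg)
  have other: "twist ?\<alpha> ?\<beta> d i = u i"
    if "d \<in> carrier P" "i \<in> {0..2*g}" "i \<notin> {?i2, ?i3, ?i4}" for d i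
    unfolding twist_def using that by simp
  have c: "?c \<in> carrier P" using cl by simp
  have par: "parity ?c = handle_a l + handle_a (Suc l)"
    using cl parity_generator[OF mem(1)] parity_generator[OF mem(2)] parity_generator[OF mem(3)]
    unfolding handle_a_def i4 by (simp add: add_ac)
  have spar: "surface_part (parity ?c) = handle_a l + handle_a (Suc l)"
    unfolding par surface_part_simps(1) unfolding handle_a_def i4 using assms by simp
  have "realised (transvection g (surface_part (parity ?c)))"
  proof (rule twist_realises_transvection[of ?c ?\<alpha> ?\<beta>, OF c])
    fix d assume "d \<in> {?c, inv ?c}"
    then have d: "d \<in> carrier P" "d \<otimes> ?c = ?c \<otimes> d" using c by auto
    show "handle_product P (twist ?\<alpha> ?\<beta> d) g = handle_product P u g"
    proof (rule handle_product_cong_pair[where l = l])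
      show "twist ?\<alpha> ?\<beta> d \<in> {1..2*g} \<rightarrow> carrier P"
        using d(1) by (auto simp: twist_def)
      show "commutator P (twist ?\<alpha> ?\<beta> d (2*m - 1)) (twist ?\<alpha> ?\<beta> d (2*m)) =
          commutator P (u (2*m - 1)) (u (2*m))" if "m \<in> {1..g} - {l, Suc l}" for m
      proof -
        have "2*m - 1 \<notin> {?i2, ?i3, ?i4}" "2*m \<notin> {?i2, ?i3, ?i4}"
          using that by auto
        moreover have "2*m - 1 \<in> {0..2*g}" "2*m \<in> {0..2*g}" using that by auto
        ultimately show ?thesis using other[OF d(1)] by metis
      qed
      show "commutator P (twist ?\<alpha> ?\<beta> d (2*l - 1)) (twist ?\<alpha> ?\<beta> d (2*l)) \<otimes>
          commutator P (twist ?\<alpha> ?\<beta> d (2 * Suc l - 1)) (twist ?\<alpha> ?\<beta> d (2 * Suc l)) =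
          commutator P (u (2*l - 1)) (u (2*l)) \<otimes> commutator P (u (2 * Suc l - 1)) (u (2 * Suc l))"
        unfolding i4 tw[OF d(1)] by (rule adjacent_twist_relation[OF cl d])
    qed (use assms in auto)
    fix h assume h: "h \<in> hom P P" "\<And>i. i \<in> {0..2*g} \<Longrightarrow> h (u i) = twist ?\<alpha> ?\<beta> d i"
    interpret h: group_hom P P h by unfold_locales (rule h(1))
    have "h ?c = h ?b \<otimes> inv (h ?a) \<otimes> inv (h ?b) \<otimes> h ?a'"
      using cl by simp
    also have "\<dots> = ?c"
      unfolding h(2)[OF mem(1)] h(2)[OF mem(2)] h(2)[OF mem(3)] tw[OF d(1)]
      by (rule adjacent_twist_curve[OF cl(1-3) d])
    finally show "h ?c = ?c" .
  next
    fix i assume i: "i \<in> {1..2*g}"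
    have "omega g (basis_vector i) (handle_a l + handle_a (Suc l)) = basis_vector i ?i2 + basis_vector i ?i4"
      using omega_handle(1)[OF assms(1)] omega_handle(1)[OF assms(2)] by simp
    then show "odd (?\<alpha> i + ?\<beta> i) \<longleftrightarrow> omega g (basis_vector i) (surface_part (parity ?c)) = 1"
      unfolding spar by (auto simp: basis_vector_def)
  qed (use assms in auto)
  then show ?thesis unfolding spar .
qed

sublocale transvection_closed g "{c \<in> vectors {1..2*g}. realised (transvection g c)}"
proof
  fix c d
  assume c: "c \<in> {c \<in> vectors {1..2*g}. realised (transvection g c)}"
    and d: "d \<in> {c \<in> vectors {1..2*g}. realised (transvection g c)}" and "omega g c d = 1"
  have "transvection g d \<circ> (transvection g c \<circ> transvection g d) = transvection g (c + d)"
    using transvection_conjugate[OF \<open>omega g c d = 1\<close>] by (simp add: fun_eq_iff)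
  moreover have "realised (transvection g d \<circ> (transvection g c \<circ> transvection g d))"
    using c d by (intro realised_compose) simp_all
  ultimately show "c + d \<in> {c \<in> vectors {1..2*g}. realised (transvection g c)}"
    using c d by simp
qed (use realised_transvection_a realised_transvection_b realised_transvection_adjacent
    in \<open>simp_all\<close>)

theorem symplectic_realised:
  assumes "symplectic g L"
  shows "realised L"
  using _ _ assms
proof (rule symplectic_generation)
  show "realised L" if "\<And>v. v \<in> vectors {1..2*g} \<Longrightarrow> L v = v" for L
    by (rule realised_cong[OF realised_identity]) (simp add: that)
  show "realised L" if "c \<in> vectors {1..2*g}" "realised (transvection g c \<circ> L)" for c L
  proof -
    have "realised (transvection g c)"
    proof (cases "c = 0")
      case True
      then show ?thesis
        by (intro realised_cong[OF realised_identity]) (simp add: transvection_def)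
    next
      case False
      then show ?thesis using nonzero_in[OF that(1)] by simp
    qed
    then have "realised (transvection g c \<circ> (transvection g c \<circ> L))"
      using that(2) by (rule realised_compose)
    moreover have "transvection g c \<circ> (transvection g c \<circ> L) = L"
      by (simp add: fun_eq_iff)
    ultimately show ?thesis by simp
  qed
qed

lemma fibre_power_central:
  assumes "y \<in> carrier P"
  shows "u 0 [^] (n :: int) \<otimes> y = y \<otimes> u 0 [^] n"
proof -
  have "(\<lambda>x. y \<otimes> x \<otimes> inv y) \<in> hom P P"
    using assms by (auto intro!: homI simp: m_assoc)
  from hom_int_pow[OF this fibre_closed is_group is_group, of n]
  have "y \<otimes> u 0 [^] n \<otimes> inv y = (y \<otimes> u 0 \<otimes> inv y) [^] n" .
  also have "y \<otimes> u 0 \<otimes> inv y = u 0"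
    unfolding fibre_central[OF assms, symmetric] using assms by (simp add: m_assoc)
  finally have "y \<otimes> u 0 [^] n \<otimes> inv y \<otimes> y = u 0 [^] n \<otimes> y"
    by simp
  then show ?thesis using assms by (simp add: m_assoc)
qed

text \<open>This is the twist along the fibre: all powers of \<open>u 0\<close> are central and cancel in the commutators.\<close>

lemma fibre_twist_automorphism:
  assumes "n 0 = 0"
  obtains k where "k \<in> auto P" "\<And>i. i \<in> {0..2*g} \<Longrightarrow> k (u i) = u i \<otimes> u 0 [^] (n i :: int)"
proof -
  let ?\<alpha> = "\<lambda>i::nat. 0 :: int"
  have tw: "twist ?\<alpha> n d i = u i \<otimes> d [^] n i" if "i \<in> {0..2*g}" for d i
    using that by (simp add: twist_def)
  have "\<exists>k. k \<in> auto P \<and> (\<forall>i\<in>{0..2*g}. k (u i) = twist ?\<alpha> n (u 0) i)"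
  proof (rule twist_automorphism[of "u 0" ?\<alpha> n, OF fibre_closed refl assms])
    fix d assume d: "d \<in> {u 0, inv (u 0)}"
    then have d_closed: "d \<in> carrier P" by auto
    have central: "d [^] m \<otimes> y = y \<otimes> d [^] m" if "y \<in> carrier P" for m :: int and y
    proof -
      have "inv (u 0) [^] m = u 0 [^] (- m)"
        by (simp add: int_pow_inv int_pow_neg)
      then show ?thesis using d fibre_power_central[OF that] by auto
    qed
    show "handle_product P (twist ?\<alpha> n d) g = handle_product P u g"
    proof (rule handle_product_cong)
      fix l assume "l \<in> {1..g}"
      then have l: "2*l - 1 \<in> {0..2*g}" "2*l \<in> {0..2*g}" by auto
      show "commutator P (twist ?\<alpha> n d (2*l - 1)) (twist ?\<alpha> n d (2*l)) =
          commutator P (u (2*l - 1)) (u (2*l))"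
        unfolding tw[OF l(1)] tw[OF l(2)]
        using central d_closed generator_closed[OF l(1)] generator_closed[OF l(2)]
        by (intro commutator_mult_central) simp_all
    qed
    fix h assume "\<And>i. i \<in> {0..2*g} \<Longrightarrow> h (u i) = twist ?\<alpha> n d i"
    from this[of 0] show "h (u 0) = u 0" using assms by (simp add: twist_def)
  qed blast
  then show thesis using that tw by metis
qed

end

context group
begin

text \<open>The inverse automorphism induces the inverse map.\<close>

lemma automorphism_induces:
  assumes "k \<in> auto G"
  obtains K where "K \<in> auto (H1 G)" "\<And>y. y \<in> carrier G \<Longrightarrow> K (hurewicz G y) = hurewicz G (k y)"
proof -
  have k: "k \<in> hom G G" "bij_betw k (carrier G) (carrier G)" "k \<in> Bij (carrier G)"
    using assms by (auto simp: auto_def Bij_def)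
  let ?l = "restrict (inv_into (carrier G) k) (carrier G)"
  have l: "?l \<in> hom G G"
    using k by (intro restrict_inv_into_hom)
  obtain K where K: "K \<in> hom (H1 G) (H1 G)" "K \<in> extensional (carrier (H1 G))"
    "\<And>y. y \<in> carrier G \<Longrightarrow> K (hurewicz G y) = (hurewicz G \<circ> k) y"
    using hom_factors_through_H1[OF elementary_2_group_H1 Group.hom_compose[OF k(1) hurewicz_hom]] by metis
  obtain M where M: "M \<in> hom (H1 G) (H1 G)"
    "\<And>y. y \<in> carrier G \<Longrightarrow> M (hurewicz G y) = (hurewicz G \<circ> ?l) y"
    using hom_factors_through_H1[OF elementary_2_group_H1 Group.hom_compose[OF l hurewicz_hom]] by metis
  have kl: "k y \<in> carrier G" "?l y \<in> carrier G" "?l (k y) = y" "k (?l y) = y" if "y \<in> carrier G" for y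
    using k(1) that Bij_inv_into_mem[OF k(3) that] bij_betw_inv_into_left[OF k(2) that] bij_betw_inv_into_right[OF k(2) that]
    by (auto simp: hom_def)
  have "bij_betw K (carrier (H1 G)) (carrier (H1 G))"
  proof (rule bij_betw_byWitness[where f' = M])
    show "\<forall>a\<in>carrier (H1 G). M (K a) = a" "\<forall>a\<in>carrier (H1 G). K (M a) = a"
      unfolding carrier_H1 using kl by (simp_all add: K(3) M(2))
    show "K ` carrier (H1 G) \<subseteq> carrier (H1 G)" "M ` carrier (H1 G) \<subseteq> carrier (H1 G)"
      using K(1) M(1) by (auto simp: hom_def)
  qed
  then have "K \<in> auto (H1 G)"
    using K(1,2) by (simp add: auto_def Bij_def)
  then show thesis using that K(3) by simp
qed

lemma on_homology_factorization:
  assumes "\<phi> \<in> hom G Z2" "y \<in> carrier G"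
  shows "on_homology G \<phi> (hurewicz G y) = \<phi> y"
proof -
  let ?Q = "\<lambda>\<psi>. \<psi> \<in> hom (H1 G) Z2 \<and> \<psi> \<in> extensional (carrier (H1 G)) \<and>
    (\<forall>y\<in>carrier G. \<phi> y = \<psi> (hurewicz G y))"
  obtain \<psi> where "?Q \<psi>"
    using hom_factors_through_H1[OF elementary_2_group_Z2 assms(1)] by metis
  moreover have "\<psi>' = \<psi>" if "?Q \<psi>" "?Q \<psi>'" for \<psi> \<psi>'
  proof (rule extensionalityI)
    show "\<psi>' \<in> extensional (carrier (H1 G))" "\<psi> \<in> extensional (carrier (H1 G))"
      using that by blast+
    show "\<psi>' a = \<psi> a" if a: "a \<in> carrier (H1 G)" for a
      using a \<open>?Q \<psi>\<close> \<open>?Q \<psi>'\<close> by (cases rule: H1_cases) metis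
  qed
  ultimately have "?Q (THE \<psi>. ?Q \<psi>)"
    by (intro theI[of ?Q \<psi>]) blast+
  then have "\<forall>y\<in>carrier G. \<phi> y = on_homology G \<phi> (hurewicz G y)"
    unfolding on_homology_def by (elim conjE)
  then show ?thesis using assms(2) by simp
qed

end

lemma (in even_presentation) H1_hom_unique:
  assumes "group A" "h \<in> hom (H1 G) A" "h' \<in> hom (H1 G) A"
    and "\<And>i. i \<in> I \<Longrightarrow> h (hurewicz G (u i)) = h' (hurewicz G (u i))" and "a \<in> carrier (H1 G)"
  shows "h a = h' a"
  using assms(5)
proof (induction a rule: H1_induct)
  show "h \<one>\<^bsub>H1 G\<^esub> = h' \<one>\<^bsub>H1 G\<^esub>"
    using hom_one[OF assms(2) group_H1 assms(1)] hom_one[OF assms(3) group_H1 assms(1)] by simp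
next
  case (mult a b)
  then show ?case using assms(2,3) by (simp add: hom_def)
qed (rule assms(4))

text \<open>As the Hurewicz map is surjective, being related can be tested on classes \<open>h y\<close>; the lifting property
  turns the image of such a class into \<open>h (k y)\<close>.\<close>

lemma weak_equivalence_iff_s_related:
  assumes "group P" "is_lift P (induced_automorphism g F x P u s f) k"
    and "\<phi> \<in> hom P Z2" "\<phi>' \<in> hom P Z2"
  shows "s_related g F x P u s f \<phi> \<phi>' \<longleftrightarrow> weakly_equivalent_by P k \<phi> \<phi>'"
proof -
  interpret group P by fact
  let ?K = "induced_automorphism g F x P u s f"
  have k: "k y \<in> carrier P" "hurewicz P (k y) = ?K (hurewicz P y)" if "y \<in> carrier P" for y
    using assms(2) that by (auto simp: is_lift_def auto_def hom_def)
  have "s_related g F x P u s f \<phi> \<phi>' \<longleftrightarrow>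
      (\<forall>y\<in>carrier P. on_homology P \<phi> (hurewicz P y) = on_homology P \<phi>' (?K (hurewicz P y)))"
    unfolding s_related_def carrier_H1 by simp
  also have "\<dots> \<longleftrightarrow> (\<forall>y\<in>carrier P. \<phi> y = \<phi>' (k y))"
  proof (rule ball_cong[OF refl])
    fix y assume y: "y \<in> carrier P"
    show "on_homology P \<phi> (hurewicz P y) = on_homology P \<phi>' (?K (hurewicz P y)) \<longleftrightarrow> \<phi> y = \<phi>' (k y)"
      unfolding k(2)[OF y, symmetric] on_homology_factorization[OF assms(3) y]
        on_homology_factorization[OF assms(4) k(1)[OF y]] ..
  qed
  finally show ?thesis by (simp add: weakly_equivalent_by_def)
qed

definition int_of_bit :: "bit \<Rightarrow> int" where
  "int_of_bit b = (if b = 1 then 1 else 0)"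

lemma int_of_bit_simps [simp]:
  "int_of_bit 0 = 0" "int_of_bit 1 = 1" "int_of_bit b \<in> carrier Z2"
  by (simp_all add: int_of_bit_def carrier_integer_mod_group)

lemma int_of_bit_add: "int_of_bit (a + b) = (int_of_bit a + int_of_bit b) mod 2"
  by (cases a; cases b) (simp_all add: int_of_bit_def)

lemma int_of_bit_inject [simp]: "int_of_bit a = int_of_bit b \<longleftrightarrow> a = b"
  by (cases a; cases b) (simp_all add: int_of_bit_def)

section \<open>Intersection product and quadratic section in coordinates\<close>

text \<open>The index sets below are written as \<open>{1..2*g}\<close>, and rewriting \<open>1\<close> to \<open>Suc 0\<close> would separate them
  from the locale parameters.\<close>

declare One_nat_def [simp del]

locale bundle_over_surface =
  base: even_presentation F "{1..2*g}" x "{surface_relator g}" + circle_bundle P g q u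
  for F :: "('a, 'c) monoid_scheme" and x :: "nat \<Rightarrow> 'a"
    and P :: "('b, 'd) monoid_scheme" (structure) and g :: nat and q :: int and u :: "nat \<Rightarrow> 'b"
begin

lemma is_intersection_product_omega:
  "is_intersection_product g F x (\<lambda>a\<in>carrier (H1 F). \<lambda>b\<in>carrier (H1 F).
     int_of_bit (omega g (base.coords a) (base.coords b)))"
  (is "is_intersection_product g F x ?B")
  unfolding is_intersection_product_def
proof (intro conjI ballI)
  have cl: "a \<otimes>\<^bsub>H1 F\<^esub> b \<in> carrier (H1 F)" if "a \<in> carrier (H1 F)" "b \<in> carrier (H1 F)" for a b
    using that base.group_H1 by (simp add: group.is_monoid monoid.m_closed)
  show "?B \<in> carrier (H1 F) \<rightarrow>\<^sub>E (carrier (H1 F) \<rightarrow>\<^sub>E carrier Z2)" by auto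
  show "?B a \<in> hom (H1 F) Z2" if "a \<in> carrier (H1 F)" for a
    by (rule homI) (use that cl in \<open>simp_all add: int_of_bit_add\<close>)
  show "(\<lambda>a. ?B a b) \<in> hom (H1 F) Z2" if "b \<in> carrier (H1 F)" for b
    by (rule homI) (use that cl in \<open>simp_all add: int_of_bit_add\<close>)
  show "?B (hurewicz F (x i)) (hurewicz F (x j)) = (if \<exists>l \<in> {1..g}. {i, j} = {2*l - 1, 2*l} then 1 else 0)"
    if ij: "i \<in> {1..2*g}" "j \<in> {1..2*g}" for i j
  proof -
    have "?B (hurewicz F (x i)) (hurewicz F (x j)) = int_of_bit (omega g (basis_vector i) (basis_vector j))"
      using ij base.parity_generator[OF ij(1)] base.parity_generator[OF ij(2)]
        base.generator_closed[OF ij(1)] base.generator_closed[OF ij(2)] by simp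
    then show ?thesis unfolding omega_basis_vector[OF ij(1)] by (simp add: int_of_bit_def)
  qed
qed

lemma is_intersection_product_unique:
  assumes B: "is_intersection_product g F x B" and B': "is_intersection_product g F x B'"
  shows "B = B'"
proof -
  have Z2: "group Z2" by simp
  have generators: "B (hurewicz F (x i)) b = B' (hurewicz F (x i)) b"
    if "i \<in> {1..2*g}" "b \<in> carrier (H1 F)" for i b
  proof (rule base.H1_hom_unique[OF Z2 _ _ _ that(2)])
    have "hurewicz F (x i) \<in> carrier (H1 F)"
      using base.generator_closed[OF that(1)] by simp
    then show "B (hurewicz F (x i)) \<in> hom (H1 F) Z2" "B' (hurewicz F (x i)) \<in> hom (H1 F) Z2"
      using B B' unfolding is_intersection_product_def by blast+
    show "B (hurewicz F (x i)) (hurewicz F (x j)) = B' (hurewicz F (x i)) (hurewicz F (x j))"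
      if "j \<in> {1..2*g}" for j
      using B B' that \<open>i \<in> {1..2*g}\<close> unfolding is_intersection_product_def by metis
  qed
  have eq: "B a b = B' a b" if "a \<in> carrier (H1 F)" "b \<in> carrier (H1 F)" for a b
  proof (rule base.H1_hom_unique[OF Z2 _ _ _ that(1), of "\<lambda>a. B a b" "\<lambda>a. B' a b"])
    show "(\<lambda>a. B a b) \<in> hom (H1 F) Z2" "(\<lambda>a. B' a b) \<in> hom (H1 F) Z2"
      using B B' that(2) unfolding is_intersection_product_def by blast+
  qed (rule generators[OF _ that(2)])
  have "B \<in> carrier (H1 F) \<rightarrow>\<^sub>E (carrier (H1 F) \<rightarrow>\<^sub>E carrier Z2)"
    "B' \<in> carrier (H1 F) \<rightarrow>\<^sub>E (carrier (H1 F) \<rightarrow>\<^sub>E carrier Z2)"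
    using B B' by (simp_all add: is_intersection_product_def)
  then show ?thesis
  proof (rule PiE_ext)
    fix a assume a: "a \<in> carrier (H1 F)"
    have "B a \<in> carrier (H1 F) \<rightarrow>\<^sub>E carrier Z2" "B' a \<in> carrier (H1 F) \<rightarrow>\<^sub>E carrier Z2"
      using B B' a by (auto simp only: is_intersection_product_def PiE_mem)
    then show "B a = B' a"
      by (rule PiE_ext) (rule eq[OF a])
  qed
qed

lemma intersection_product_eq:
  assumes "a \<in> carrier (H1 F)" "b \<in> carrier (H1 F)"
  shows "intersection_product g F x a b = int_of_bit (omega g (base.coords a) (base.coords b))"
proof -
  have "intersection_product g F x = (\<lambda>a\<in>carrier (H1 F). \<lambda>b\<in>carrier (H1 F).
     int_of_bit (omega g (base.coords a) (base.coords b)))"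
    unfolding intersection_product_def
    by (rule the_equality) (rule is_intersection_product_omega,
      rule is_intersection_product_unique[OF _ is_intersection_product_omega])
  then show ?thesis using assms by simp
qed

definition scaled_fibre :: "bit \<Rightarrow> nat \<Rightarrow> bit" where
  "scaled_fibre b = (if b = 1 then basis_vector 0 else 0)"

lemma scaled_fibre_simps [simp]:
  "scaled_fibre 0 = 0" "scaled_fibre 1 = basis_vector 0" "scaled_fibre b \<in> vectors {0..2*g}"
  "surface_part (scaled_fibre b) = 0"
  by (simp_all add: scaled_fibre_def)

lemma scaled_fibre_add: "scaled_fibre (a + b) = scaled_fibre a + scaled_fibre b"
  by (cases a; cases b) (simp_all add: scaled_fibre_def)

lemma fibre_class_pow:
  "hurewicz P (u 0) [^]\<^bsub>H1 P\<^esub> int_of_bit b = of_coords (scaled_fibre b)"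
proof (cases "b = 1")
  case False
  have "of_coords 0 = \<one>\<^bsub>H1 P\<^esub>"
    by (rule hom_one[OF of_coords_hom group_vectors group_H1, simplified])
  then show ?thesis using False by simp
next
  case True
  then show ?thesis
    using of_coords_basis_vector[of 0] by (simp add: group.int_pow_1[OF group_H1])
qed

text \<open>The quadratic form with polarization \<open>omega\<close> that takes the value \<open>r\<^sub>i\<close> on the \<open>i\<close>-th basis vector
  describes the component of the section along the fibre.\<close>

definition section_vector :: "(nat \<Rightarrow> int) \<Rightarrow> (nat \<Rightarrow> bit) \<Rightarrow> (nat \<Rightarrow> bit)" where
  "section_vector r v = v + scaled_fibre
     ((\<Sum>i\<in>{1..2*g}. of_int (r i) * v i) + (\<Sum>l\<in>{1..g}. v (2*l - 1) * v (2*l)))"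

lemma section_vector_in_vectors:
  assumes "v \<in> vectors {1..2*g}"
  shows "section_vector r v \<in> vectors {0..2*g}" "surface_part (section_vector r v) = v"
proof -
  have "v \<in> vectors {0..2*g}" "v 0 = 0"
    using assms by (auto simp: vectors_def)
  then show "section_vector r v \<in> vectors {0..2*g}" "surface_part (section_vector r v) = v"
    by (simp_all add: section_vector_def) (simp add: surface_part_def fun_eq_iff)
qed

lemma section_vector_basis_vector:
  assumes "i \<in> {1..2*g}"
  shows "section_vector r (basis_vector i) = basis_vector i + scaled_fibre (of_int (r i))"
proof -
  have "(\<Sum>j\<in>{1..2*g}. of_int (r j) * basis_vector i j) = (\<Sum>j\<in>{1..2*g}. if j = i then of_int (r i) else (0::bit))"
    by (rule sum.cong) (auto simp: basis_vector_def)
  then have "(\<Sum>j\<in>{1..2*g}. of_int (r j) * basis_vector i j) = of_int (r i)"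
    using assms by simp
  moreover have "(\<Sum>l\<in>{1..g}. basis_vector i (2*l - 1) * basis_vector i (2*l)) = 0"
    by (rule sum.neutral) (auto simp: basis_vector_def)
  ultimately show ?thesis by (simp add: section_vector_def)
qed

lemma section_vector_add:
  "section_vector r (v + w) = section_vector r v + section_vector r w + scaled_fibre (omega g v w)"
proof -
  let ?lin = "\<lambda>v. \<Sum>i\<in>{1..2*g}. of_int (r i) * v i" and ?quad = "\<lambda>v. \<Sum>l\<in>{1..g}. v (2*l - 1) * v (2*l)"
  have "?lin (v + w) = ?lin v + ?lin w"
    by (simp add: plus_fun_apply distrib_left sum.distrib)
  moreover have "?quad (v + w) = ?quad v + ?quad w + omega g v w"
    unfolding omega_def sum.distrib[symmetric]
    by (rule sum.cong) (simp_all add: plus_fun_apply algebra_simps)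
  ultimately show ?thesis
    by (simp add: section_vector_def scaled_fibre_add add_ac)
qed

lemma H1_mult_closed:
  "a \<in> carrier (H1 F) \<Longrightarrow> b \<in> carrier (H1 F) \<Longrightarrow> a \<otimes>\<^bsub>H1 F\<^esub> b \<in> carrier (H1 F)"
  by (simp add: base.group_H1 group.is_monoid monoid.m_closed)

lemma is_quadratic_section_explicit:
  assumes r: "\<forall>i\<in>{1..2*g}. r i \<in> carrier Z2"
  shows "is_quadratic_section g F x P u r
    (\<lambda>a\<in>carrier (H1 F). of_coords (section_vector r (base.coords a)))"
  (is "is_quadratic_section g F x P u r ?s")
  unfolding is_quadratic_section_def
proof (intro conjI ballI)
  show "?s \<in> carrier (H1 F) \<rightarrow>\<^sub>E carrier (H1 P)"
    using section_vector_in_vectors(1) by auto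
next
  fix i assume i: "i \<in> {1..2*g}"
  then have i0: "i \<in> {0..2*g}" by auto
  have "0 \<le> r i" "r i < 2" using r i by (auto simp: carrier_integer_mod_group)
  then have "r i = 0 \<or> r i = 1" by linarith
  then have "r i = int_of_bit (of_int (r i))" by auto
  then have pow: "hurewicz P (u 0) [^]\<^bsub>H1 P\<^esub> r i = of_coords (scaled_fibre (of_int (r i)))"
    using fibre_class_pow[of "of_int (r i)"] by simp
  have "?s (hurewicz F (x i)) = of_coords (section_vector r (basis_vector i))"
    using base.generator_closed[OF i] base.parity_generator[OF i] by simp
  also have "\<dots> = of_coords (basis_vector i) \<otimes>\<^bsub>H1 P\<^esub> of_coords (scaled_fibre (of_int (r i)))"
    unfolding section_vector_basis_vector[OF i] using i0 by (intro of_coords_add) simp_all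
  finally show "?s (hurewicz F (x i)) = hurewicz P (u i) \<otimes>\<^bsub>H1 P\<^esub> (hurewicz P (u 0) [^]\<^bsub>H1 P\<^esub> r i)"
    unfolding pow of_coords_basis_vector[OF i0] .
next
  fix a b assume ab: "a \<in> carrier (H1 F)" "b \<in> carrier (H1 F)"
  let ?v = "base.coords a" and ?w = "base.coords b"
  have vw: "?v \<in> vectors {1..2*g}" "?w \<in> vectors {1..2*g}" using ab by simp_all
  have "?s (a \<otimes>\<^bsub>H1 F\<^esub> b) = of_coords (section_vector r (?v + ?w))"
    using ab H1_mult_closed by simp
  also have "\<dots> = of_coords (section_vector r ?v) \<otimes>\<^bsub>H1 P\<^esub> of_coords (section_vector r ?w) \<otimes>\<^bsub>H1 P\<^esub>
      of_coords (scaled_fibre (omega g ?v ?w))"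
    unfolding section_vector_add using section_vector_in_vectors(1)[OF vw(1)] section_vector_in_vectors(1)[OF vw(2)]
    by (simp add: of_coords_add)
  finally show "?s (a \<otimes>\<^bsub>H1 F\<^esub> b) = ?s a \<otimes>\<^bsub>H1 P\<^esub> ?s b \<otimes>\<^bsub>H1 P\<^esub>
      (hurewicz P (u 0) [^]\<^bsub>H1 P\<^esub> intersection_product g F x a b)"
    using ab by (simp add: intersection_product_eq fibre_class_pow)
qed

text \<open>The value at the neutral element is forced, since that element has product 0 with itself and every
  class has order at most 2. The quadratic law then determines all values from those on the
  generators.\<close>

lemma is_quadratic_section_unique:
  assumes s: "is_quadratic_section g F x P u r s" and s': "is_quadratic_section g F x P u r s'"
  shows "s = s'"
proof -
  have pi: "t \<in> carrier (H1 F) \<rightarrow>\<^sub>E carrier (H1 P)" if "is_quadratic_section g F x P u r t" for t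
    using that by (simp add: is_quadratic_section_def)
  have mult: "t (a \<otimes>\<^bsub>H1 F\<^esub> b) = t a \<otimes>\<^bsub>H1 P\<^esub> t b \<otimes>\<^bsub>H1 P\<^esub>
      (hurewicz P (u 0) [^]\<^bsub>H1 P\<^esub> intersection_product g F x a b)"
    if "is_quadratic_section g F x P u r t" "a \<in> carrier (H1 F)" "b \<in> carrier (H1 F)" for t a b
    using that by (simp add: is_quadratic_section_def)
  have one: "t \<one>\<^bsub>H1 F\<^esub> = \<one>\<^bsub>H1 P\<^esub>" if t: "is_quadratic_section g F x P u r t" for t
  proof -
    have 1: "\<one>\<^bsub>H1 F\<^esub> \<in> carrier (H1 F)" by (simp add: base.group_H1 group.is_monoid monoid.one_closed)
    then have "t \<one>\<^bsub>H1 F\<^esub> \<in> carrier (H1 P)" using pi[OF t] by (auto simp: PiE_mem)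
    then have square: "t \<one>\<^bsub>H1 F\<^esub> \<otimes>\<^bsub>H1 P\<^esub> t \<one>\<^bsub>H1 F\<^esub> = \<one>\<^bsub>H1 P\<^esub>"
      using elementary_2_group_H1 by (simp add: elementary_2_group_def)
    have "t \<one>\<^bsub>H1 F\<^esub> = t (\<one>\<^bsub>H1 F\<^esub> \<otimes>\<^bsub>H1 F\<^esub> \<one>\<^bsub>H1 F\<^esub>)"
      using 1 base.group_H1 by (simp add: group.is_monoid monoid.l_one)
    also have "\<dots> = \<one>\<^bsub>H1 P\<^esub>"
      unfolding mult[OF t 1 1] square intersection_product_eq[OF 1 1]
      by (simp add: group_H1 group.is_monoid monoid.l_one monoid.one_closed)
    finally show ?thesis .
  qed
  have "s a = s' a" if "a \<in> carrier (H1 F)" for a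
    using that
  proof (induction a rule: base.H1_induct)
    case (generator i)
    then show ?case using s s' unfolding is_quadratic_section_def by metis
  qed (simp_all add: one[OF s] one[OF s'] mult[OF s] mult[OF s'])
  then show ?thesis using pi[OF s] pi[OF s'] by (intro PiE_ext[of s _ _ s']) auto
qed

lemma quadratic_section_explicit:
  assumes "\<forall>i\<in>{1..2*g}. r i \<in> carrier Z2"
  shows "quadratic_section g F x P u r =
    (\<lambda>a\<in>carrier (H1 F). of_coords (section_vector r (base.coords a)))"
  unfolding quadratic_section_def
  by (rule the_equality) (rule is_quadratic_section_explicit[OF assms],
    rule is_quadratic_section_unique[OF _ is_quadratic_section_explicit[OF assms]])

section \<open>Existence of lifts\<close>

lemma symplectic_coordinates:
  assumes f: "symplectic_automorphism g F x f"
  shows "symplectic g (\<lambda>v. base.coords (f (base.of_coords v)))"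
proof -
  have hom: "f (a \<otimes>\<^bsub>H1 F\<^esub> b) = f a \<otimes>\<^bsub>H1 F\<^esub> f b" "f a \<in> carrier (H1 F)"
    "omega g (base.coords (f a)) (base.coords (f b)) = omega g (base.coords a) (base.coords b)"
    if "a \<in> carrier (H1 F)" "b \<in> carrier (H1 F)" for a b
  proof -
    show "f (a \<otimes>\<^bsub>H1 F\<^esub> b) = f a \<otimes>\<^bsub>H1 F\<^esub> f b" and fa: "f a \<in> carrier (H1 F)"
      using f that by (auto simp: symplectic_automorphism_def auto_def hom_def)
    have "f b \<in> carrier (H1 F)"
      using f that by (auto simp: symplectic_automorphism_def auto_def hom_def)
    moreover have "intersection_product g F x (f a) (f b) = intersection_product g F x a b"
      using f that by (auto simp: symplectic_automorphism_def)
    ultimately show "omega g (base.coords (f a)) (base.coords (f b)) = omega g (base.coords a) (base.coords b)"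
      using fa that by (simp add: intersection_product_eq)
  qed
  show ?thesis
    unfolding symplectic_def
  proof (intro conjI ballI)
    fix v w assume vw: "v \<in> vectors {1..2*g}" "w \<in> vectors {1..2*g}"
    have cl: "base.of_coords v \<in> carrier (H1 F)" "base.of_coords w \<in> carrier (H1 F)"
      using vw by simp_all
    show "base.coords (f (base.of_coords (v + w))) = base.coords (f (base.of_coords v)) + base.coords (f (base.of_coords w))"
      using hom(1)[OF cl] hom(2)[OF cl] hom(2)[OF cl(2,1)] vw by (simp add: base.of_coords_add)
    show "omega g (base.coords (f (base.of_coords v))) (base.coords (f (base.of_coords w))) = omega g v w"
      using hom(3)[OF cl] vw by simp
    next
    fix v assume "v \<in> vectors {1..2*g}"
    then have v: "base.of_coords v \<in> carrier (H1 F)" by simp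
    then show "base.coords (f (base.of_coords v)) \<in> vectors {1..2*g}"
      using hom(2)[OF v v] by simp
  qed
qed

theorem lift_exists:
  assumes r: "\<forall>i\<in>{1..2*g}. r i \<in> carrier Z2" and s: "s = quadratic_section g F x P u r"
    and f: "symplectic_automorphism g F x f"
  shows "\<exists>k. is_lift P (induced_automorphism g F x P u s f) k"
proof -
  let ?L = "\<lambda>v. base.coords (f (base.of_coords v))"
  have s_sec: "is_quadratic_section g F x P u r s"
    unfolding s quadratic_section_explicit[OF r] by (rule is_quadratic_section_explicit[OF r])
  have f_closed: "f (hurewicz F (x i)) \<in> carrier (H1 F)" if "i \<in> {1..2*g}" for i
    using f base.generator_closed[OF that]
    by (auto simp: symplectic_automorphism_def auto_def hom_def Pi_def)
  have s_closed: "s a \<in> carrier (H1 P)" if "a \<in> carrier (H1 F)" for a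
    using s_sec that by (auto simp: is_quadratic_section_def)
  have s_gen: "s (hurewicz F (x i)) = hurewicz P (u i \<otimes> u 0 [^] r i)" if "i \<in> {1..2*g}" for i
  proof -
    have "i \<in> {0..2*g}" using that by auto
    then show ?thesis
      using s_sec that hom_int_pow[OF hurewicz_hom fibre_closed is_group group_H1, of "r i"]
      by (simp add: is_quadratic_section_def hurewicz_mult)
  qed
  \<comment> \<open>\<open>t i\<close> is the class that the lift must give to \<open>u i\<close>. The term in \<open>r i\<close> appears because \<open>f\<^sub>s\<close> is
    prescribed on \<open>\<nu>\<^sub>i + r\<^sub>i \<nu>\<^sub>0\<close>.\<close>
  define t where "t i = coords (s (f (hurewicz F (x i)))) + scaled_fibre (of_int (r i))" for i
  obtain k0 where k0: "k0 \<in> auto P" "k0 (u 0) = u 0"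
    "\<And>y. y \<in> carrier P \<Longrightarrow> surface_part (parity (k0 y)) = ?L (surface_part (parity y))"
    using symplectic_realised[OF symplectic_coordinates[OF f]] unfolding realised_def by blast
  have t: "t i = parity (k0 (u i)) \<or> t i = parity (k0 (u i)) + basis_vector 0" if i: "i \<in> {1..2*g}" for i
  proof (rule surface_part_eqD)
    have i0: "i \<in> {0..2*g}" "i > 0" using i by auto
    have "surface_part (t i) = base.coords (f (hurewicz F (x i)))"
      using f_closed[OF i] section_vector_in_vectors
      by (simp add: t_def s quadratic_section_explicit[OF r])
    also have "\<dots> = ?L (basis_vector i)"
      using base.of_coords_basis_vector[OF i] by simp
    also have "\<dots> = surface_part (parity (k0 (u i)))"
      unfolding k0(3)[OF generator_closed[OF i0(1)]] parity_generator[OF i0(1)] surface_part_simps(4)[OF i0(2)] ..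
    finally show "surface_part (t i) = surface_part (parity (k0 (u i)))" .
  qed
  define n :: "nat \<Rightarrow> int" where "n i = (if i = 0 \<or> t i = parity (k0 (u i)) then 0 else 1)" for i
  \<comment> \<open>The twist is applied first: \<open>k0\<close> fixes \<open>u 0\<close> and carries the correction along unchanged.\<close>
  obtain \<tau> where \<tau>: "\<tau> \<in> auto P" "\<And>i. i \<in> {0..2*g} \<Longrightarrow> \<tau> (u i) = u i \<otimes> u 0 [^] n i"
    using fibre_twist_automorphism[of n] by (auto simp: n_def)
  let ?k = "compose (carrier P) k0 \<tau>"
  have k_auto: "?k \<in> auto P" by (rule auto_compose[OF k0(1) \<tau>(1)])
  have k0_hom: "k0 \<in> hom P P" using k0(1) by (simp add: auto_def)
  have k_gen: "?k (u i) = k0 (u i) \<otimes> u 0 [^] n i" if "i \<in> {0..2*g}" for i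
    using that k0_hom hom_int_pow[OF k0_hom fibre_closed is_group is_group, of "n i"] k0(2) \<tau>(2)[OF that]
    by (simp add: compose_eq hom_mult)
  have k_fibre: "?k (u 0) = u 0"
    using k_gen[of 0] k0(2) by (simp add: n_def)
  have k_parity: "parity (?k (u i)) = t i" if i: "i \<in> {1..2*g}" for i
  proof -
    have i0: "i \<in> {0..2*g}" "i \<noteq> 0" using i by auto
    have "k0 (u i) \<in> carrier P" using auto_closed[OF k0(1) generator_closed[OF i0(1)]] .
    then show ?thesis
      using t[OF i] i0(2) unfolding k_gen[OF i0(1)] by (auto simp: n_def)
  qed
  obtain K where K: "K \<in> auto (H1 P)" "\<And>y. y \<in> carrier P \<Longrightarrow> K (hurewicz P y) = hurewicz P (?k y)"
    using automorphism_induces[OF k_auto] by metis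
  let ?spec = "\<lambda>K. K \<in> auto (H1 P) \<and>
        (\<forall>i \<in> {1..2*g}. K (s (hurewicz F (x i))) = s (f (hurewicz F (x i)))) \<and>
        K (hurewicz P (u 0)) = hurewicz P (u 0)"
  have K_spec: "?spec K"
  proof (intro conjI ballI)
    show "K (hurewicz P (u 0)) = hurewicz P (u 0)"
      using K(2)[OF fibre_closed] k_fibre by simp
    fix i assume i: "i \<in> {1..2*g}"
    have i0: "i \<in> {0..2*g}" using i by auto
    have k_hom: "?k \<in> hom P P" using k_auto by (simp add: auto_def)
    have ki: "?k (u i) \<in> carrier P" using auto_closed[OF k_auto generator_closed[OF i0]] .
    have "?k (u i \<otimes> u 0 [^] r i) = ?k (u i) \<otimes> ?k (u 0 [^] r i)"
      using k_hom generator_closed[OF i0] by (simp only: hom_mult int_pow_closed fibre_closed)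
    also have "?k (u 0 [^] r i) = u 0 [^] r i"
      using hom_int_pow[OF k_hom fibre_closed is_group is_group, of "r i"] k_fibre by simp
    finally have k_eq: "?k (u i \<otimes> u 0 [^] r i) = ?k (u i) \<otimes> u 0 [^] r i" .
    have "parity (u 0 [^] r i) = basis_vector 0 [^]\<^bsub>vector_group {0..2*g}\<^esub> r i"
      using hom_int_pow[OF parity_hom fibre_closed is_group group_vectors, of "r i"] by simp
    also have "\<dots> = scaled_fibre (of_int (r i))"
    proof -
      have "0 \<le> r i" "r i < 2" using r i by (auto simp: carrier_integer_mod_group)
      then have "r i = 0 \<or> r i = 1" by linarith
      then show ?thesis by (subst vector_group_int_pow) (auto simp: scaled_fibre_def)
    qed
    finally have "parity (?k (u i \<otimes> u 0 [^] r i)) = coords (s (f (hurewicz F (x i))))"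
      unfolding k_eq using ki k_parity[OF i] by (simp add: t_def add_ac)
    moreover have "K (s (hurewicz F (x i))) = of_coords (parity (?k (u i \<otimes> u 0 [^] r i)))"
    proof -
      have cl: "u i \<otimes> u 0 [^] r i \<in> carrier P" using generator_closed[OF i0] by simp
      show ?thesis
        unfolding s_gen[OF i] K(2)[OF cl] by (rule of_coords_parity[OF auto_closed[OF k_auto cl], symmetric])
    qed
    ultimately show "K (s (hurewicz F (x i))) = s (f (hurewicz F (x i)))"
      using s_closed[OF f_closed[OF i]] by simp
  qed (rule K(1))
  have K_unique: "K' = K" if K': "?spec K'" for K'
  proof -
    have homs: "K' \<in> hom (H1 P) (H1 P)" "K \<in> hom (H1 P) (H1 P)"
      "K' \<in> extensional (carrier (H1 P))" "K \<in> extensional (carrier (H1 P))"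
      using K' K(1) by (auto simp: auto_def Bij_def)
    have "K' (hurewicz P (u i)) = K (hurewicz P (u i))" if i: "i \<in> {0..2*g}" for i
    proof (cases "i = 0")
      case True
      then show ?thesis using K' K_spec by simp
    next
      case False
      then have i1: "i \<in> {1..2*g}" using i by simp
      have split: "M (s (hurewicz F (x i))) = M (hurewicz P (u i)) \<otimes>\<^bsub>H1 P\<^esub> hurewicz P (u 0) [^]\<^bsub>H1 P\<^esub> r i"
        if M: "?spec M" for M
      proof -
        have M_hom: "M \<in> hom (H1 P) (H1 P)" using M by (simp add: auto_def)
        have pow: "hurewicz P (u 0) [^]\<^bsub>H1 P\<^esub> r i \<in> carrier (H1 P)"
          by (simp add: group_H1 group.int_pow_closed)
        have "s (hurewicz F (x i)) = hurewicz P (u i) \<otimes>\<^bsub>H1 P\<^esub> hurewicz P (u 0) [^]\<^bsub>H1 P\<^esub> r i"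
          using s_sec i1 by (simp add: is_quadratic_section_def)
        moreover have "M (hurewicz P (u 0) [^]\<^bsub>H1 P\<^esub> r i) = hurewicz P (u 0) [^]\<^bsub>H1 P\<^esub> r i"
          using hom_int_pow[OF M_hom _ group_H1 group_H1, of "hurewicz P (u 0)" "r i"] M by simp
        ultimately show ?thesis
          using hom_mult[OF M_hom _ pow, of "hurewicz P (u i)"] i by simp
      qed
      have "K' (s (hurewicz F (x i))) = K (s (hurewicz F (x i)))"
        using K' K_spec i1 by metis
      then have "K' (hurewicz P (u i)) \<otimes>\<^bsub>H1 P\<^esub> hurewicz P (u 0) [^]\<^bsub>H1 P\<^esub> r i =
          K (hurewicz P (u i)) \<otimes>\<^bsub>H1 P\<^esub> hurewicz P (u 0) [^]\<^bsub>H1 P\<^esub> r i"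
        unfolding split[OF K'] split[OF K_spec] .
      moreover have "M (hurewicz P (u i)) \<in> carrier (H1 P)" if "M \<in> hom (H1 P) (H1 P)" for M
        using that i by (auto simp: hom_def Pi_def)
      ultimately show ?thesis
        using homs group.right_cancel[OF group_H1] by (simp add: group_H1 group.int_pow_closed)
    qed
    then have "K' a = K a" if "a \<in> carrier (H1 P)" for a
      by (rule H1_hom_unique[OF group_H1 homs(1,2) _ that])
    then show ?thesis using homs(3,4) by (intro extensionalityI)
  qed
  have "induced_automorphism g F x P u s f = K"
    unfolding induced_automorphism_def by (rule the_equality) (rule K_spec, rule K_unique)
  then have "is_lift P (induced_automorphism g F x P u s f) ?k"
    unfolding is_lift_def using k_auto K(2) by simp
  then show ?thesis by (intro exI[of _ ?k])
qed

end
theorem theorem14: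
  fixes g :: nat and q :: int
    and F :: "('a, 'c) monoid_scheme" and x :: "nat \<Rightarrow> 'a"
    and P :: "('b, 'd) monoid_scheme" and u :: "nat \<Rightarrow> 'b"
    and r :: "nat \<Rightarrow> int" and s :: "'a set \<Rightarrow> 'b set"
  assumes "g \<ge> 1" and "even q"
    and "surface_group g F x"
    and "circle_bundle_group g q P u"
    and "\<forall>i \<in> {1..2*g}. r i \<in> carrier Z2"
    and "s = quadratic_section g F x P u r"
  shows "(\<forall>f. symplectic_automorphism g F x f \<longrightarrow>
            (\<exists>k. is_lift P (induced_automorphism g F x P u s f) k)) \<and>
         (\<forall>f k \<phi> \<phi>'.
            symplectic_automorphism g F x f \<longrightarrow>
            is_lift P (induced_automorphism g F x P u s f) k \<longrightarrow>
            \<phi> \<in> special_monodromies P u \<longrightarrow>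
            \<phi>' \<in> special_monodromies P u \<longrightarrow>
            (s_related g F x P u s f \<phi> \<phi>' \<longleftrightarrow> weakly_equivalent_by P k \<phi> \<phi>'))"
proof -
  have "group F" "group P"
    using assms(3,4) by (simp_all add: surface_group_def circle_bundle_group_def has_presentation_def)
  interpret bundle_over_surface F x P g q u
  proof (intro bundle_over_surface.intro even_presentation.intro circle_bundle.intro
      even_presentation_axioms.intro circle_bundle_axioms.intro)
    show "group F" "group P" by fact+
    show "has_presentation F {1..2*g} x {surface_relator g}"
      using assms(3) by (simp add: surface_group_def)
    show "eval_word (vector_group {1..2*g}) basis_vector w = 0" if "w \<in> {surface_relator g}" for w
      using that by (rule surface_relator_even)
  qed (use assms(2,4) in simp_all)
  show ?thesis
  proof (intro conjI allI impI)
    fix f assume "symplectic_automorphism g F x f"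
    then show "\<exists>k. is_lift P (induced_automorphism g F x P u s f) k"
      by (rule lift_exists[OF assms(5,6)])
  next
    fix f k \<phi> \<phi>'
    assume "is_lift P (induced_automorphism g F x P u s f) k"
      and "\<phi> \<in> special_monodromies P u" "\<phi>' \<in> special_monodromies P u"
    then show "s_related g F x P u s f \<phi> \<phi>' \<longleftrightarrow> weakly_equivalent_by P k \<phi> \<phi>'"
      using \<open>group P\<close> by (intro weak_equivalence_iff_s_related) (simp_all add: special_monodromies_def)
  qed
qed

end
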